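(* Let $k\ge n\ge 1$ and let $f_1,\dots,f_k$ be tropical polynomials in $n$ variables, where infinite coefficients are allowed. Then the number of isolated solutions of the system $f_1,\dots,f_k$ is not greater than $$\frac{\binom{k+4n}{3n}}{k+n+1}\,D,$$ where $D$ is the product of the $n$ greatest tropical degrees of the given polynomials.
   Context: A tropical polynomial $f$ in $n$ variables is given by a nonempty finite set of tropical monomials $Q_j(x)=a_j+i_{j1}x_1+\cdots+i_{jn}x_n$ with $a_j\in\mathbb{R}$ and pairwise distinct exponent vectors $(i_{j1},\dots,i_{jn})\in\mathbb{Z}_{\ge 0}^n$; $f(x)=\min_j Q_j(x)$. The tropical degree of $Q_j$ is $i_{j1}+\cdots+i_{jn}$, and the tropical degree of $f$ is the maximum of the degrees of its monomials. A monomial not occurring in $f$ is said to have coefficient $\infty$; "infinite coefficients are allowed" means that any monomials may be missing from the polynomials. A point $x\in\mathbb{R}^n$ is a tropical zero of $f$ if $\min_j Q_j(x)$ is attained for at least two different values of $j$. A solution of a system $f_1,\dots,f_k$ is a point of $\mathbb{R}^n$ that is a tropical zero of every $f_i$; the set of all solutions is the tropical prevariety $V\subset\mathbb{R}^n$ of the system. An isolated solution is an isolated point of $V$. *)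

theory Defs
  imports "HOL-Analysis.Analysis"
begin

(* A polynomial maps an exponent vector to its coefficient; None is the coefficient infinity,
   i.e. the monomial does not occur. *)
type_synonym 'n trop_poly = "('n \<Rightarrow> nat) \<rightharpoonup> real"

definition tropical_polynomial :: "'n::finite trop_poly \<Rightarrow> bool" where
  "tropical_polynomial f \<longleftrightarrow> finite (dom f) \<and> dom f \<noteq> {}"

(* Only meaningful for i in dom f. *)
definition trop_monomial_value ::
  "'n::finite trop_poly \<Rightarrow> ('n \<Rightarrow> nat) \<Rightarrow> real ^ 'n \<Rightarrow> real" where
  "trop_monomial_value f i x = the (f i) + (\<Sum>l\<in>UNIV. real (i l) * x $ l)"

definition trop_eval :: "'n::finite trop_poly \<Rightarrow> real ^ 'n \<Rightarrow> real" where
  "trop_eval f x = Min ((\<lambda>i. trop_monomial_value f i x) ` dom f)"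

definition trop_monomial_degree :: "('n::finite \<Rightarrow> nat) \<Rightarrow> nat" where
  "trop_monomial_degree i = (\<Sum>l\<in>UNIV. i l)"

definition trop_degree :: "'n::finite trop_poly \<Rightarrow> nat" where
  "trop_degree f = Max (trop_monomial_degree ` dom f)"

definition trop_zero :: "'n::finite trop_poly \<Rightarrow> real ^ 'n \<Rightarrow> bool" where
  "trop_zero f x \<longleftrightarrow> (\<exists>i\<in>dom f. \<exists>j\<in>dom f. i \<noteq> j \<and>
     trop_monomial_value f i x = trop_eval f x \<and> trop_monomial_value f j x = trop_eval f x)"

definition trop_prevariety :: "'n::finite trop_poly list \<Rightarrow> (real ^ 'n) set" where
  "trop_prevariety fs = {x. \<forall>f\<in>set fs. trop_zero f x}"

(* Degrees are taken with multiplicity, so equal degrees of different members count separately. *)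
definition greatest_degrees_prod :: "nat \<Rightarrow> 'n::finite trop_poly list \<Rightarrow> nat" where
  "greatest_degrees_prod m fs = prod_list (take m (rev (sort (map trop_degree fs))))"

end

theory Submission
  imports Defs
begin

text \<open>
  Write \<open>k\<close> for the number of polynomials, \<open>n\<close> for the number of variables and \<open>D\<close> for the product
  of the \<open>n\<close> greatest degrees. The number of isolated solutions is in fact at most \<open>D k^n / n!\<close>,
  a number of cells of volume at least \<open>1 / D\<close> that fit without overlap into a simplex of volume
  \<open>k^n / n!\<close>; an elementary estimate of binomial coefficients then gives the bound.

  Weight the polynomial \<open>f_i\<close>, of degree \<open>d_i\<close>, by \<open>1 / d_i\<close>, and let \<open>g\<close> be the concave function
  \<open>f_1 / d_1 + ... + f_k / d_k\<close>. At a solution \<open>x\<close> choose for every \<open>i\<close> one or two exponent vectors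
  whose monomials attain the minimum of \<open>f_i\<close> at \<open>x\<close>. The weighted Minkowski sum of these points
  and segments consists of supergradients of \<open>g\<close> at \<open>x\<close>, and a supergradient at \<open>x\<close> that is interior
  to such a cell is not a supergradient at any other point (\<open>supergradient_cells_disjoint\<close>). So the
  cells of different solutions do not overlap. Since \<open>f_i / d_i\<close> has its exponents in the standard
  simplex, all cells lie in \<open>k\<close> times that simplex. If \<open>n\<close> of the chosen segments, coming from \<open>n\<close>
  different polynomials, have linearly independent directions, the cell is a parallelepiped with
  integral edges, scaled by the corresponding \<open>n\<close> factors \<open>1 / d_i\<close>; its volume is therefore at
  least \<open>1 / D\<close> (\<open>measure_lattice_parallelepiped\<close>).

  It remains to see that at an isolated solution such independent directions exist
  (\<open>transversal_if_isolated\<close>). Take as many independent directions from different polynomials as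
  possible and suppose that there are fewer than \<open>n\<close>. A tropical walk
  (\<open>fan_transversal_positive\<close>) finds a nonzero vector \<open>w\<close> along which, for each of the selected
  polynomials, at least two of the monomials minimal at \<open>x\<close> stay tied and minimal. It does so
  stably: these monomials again contain independent directions, all orthogonal to \<open>w\<close>. By
  maximality, for every other polynomial the differences of the exponents that are minimal at \<open>x\<close>
  lie in the span of these directions, so its minimal monomials all stay tied along \<open>w\<close>. Hence
  \<open>x + e w\<close> is a solution for all small \<open>e > 0\<close>, and \<open>x\<close> is not isolated.
\<close>

section \<open>Linear systems given by rows\<close>

lemma det_nz_solve:
  fixes M :: "real^'n^'n"
  assumes "det M \<noteq> 0"
  obtains x where "\<And>j. M $ j \<bullet> x = y j"
proof -
  from assms have "surj ((*v) M)"
    using invertible_det_nz[of M] matrix_right_invertible_surjective[of M] by (auto simp: invertible_def)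
  then obtain x where "M *v x = (\<chi> j. y j)" by (metis surjE)
  then have "M $ j \<bullet> x = y j" for j by (metis matrix_vector_mul_component vec_lambda_beta)
  then show ?thesis using that by blast
qed

lemma det_0_iff_kernel:
  fixes M :: "real^'n^'n"
  shows "det M = 0 \<longleftrightarrow> (\<exists>x. x \<noteq> 0 \<and> M *v x = 0)"
  using invertible_det_nz[of M] matrix_left_invertible_ker[of M] invertible_left_inverse[of M] by auto

lemma det_nz_kernel:
  fixes M :: "real^'n^'n"
  assumes "det M \<noteq> 0" "\<And>j. M $ j \<bullet> x = 0"
  shows "x = 0"
proof -
  have "M *v x = 0" using assms(2) by (simp add: vec_eq_iff matrix_vector_mul_component)
  then show ?thesis using assms(1) det_0_iff_kernel[of M] by blast
qed

text \<open>
  The rows of \<open>M\<close> other than row \<open>i\<close> are rows of a regular matrix, so they span a hyperplane. The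
  vector \<open>z\<close> is normal to it, and row \<open>i\<close> lies off the hyperplane because it is not orthogonal to \<open>z\<close>.
\<close>

lemma det_replace_row:
  fixes M M0 :: "real^'n^'n"
  assumes M0: "det M0 \<noteq> 0" and same: "\<And>j. j \<noteq> i \<Longrightarrow> M $ j = M0 $ j"
    and z: "\<And>j. j \<noteq> i \<Longrightarrow> M $ j \<bullet> z = 0" "M $ i \<bullet> z \<noteq> 0"
  shows "det M \<noteq> 0"
proof
  assume "det M = 0"
  then have "det (transpose M) = 0" by simp
  then obtain y where y: "y \<noteq> 0" "transpose M *v y = 0"
    using det_0_iff_kernel by blast
  have comb: "(\<Sum>j\<in>UNIV. y $ j *\<^sub>R (M $ j)) = 0"
    using y(2) by (simp add: vec_eq_iff matrix_vector_mult_def transpose_def mult.commute)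
  have "0 = (\<Sum>j\<in>UNIV. y $ j *\<^sub>R (M $ j)) \<bullet> z" by (simp add: comb)
  also have "\<dots> = (\<Sum>j\<in>UNIV. y $ j * (M $ j \<bullet> z))" by (simp add: inner_sum_left)
  also have "\<dots> = (\<Sum>j\<in>UNIV. if j = i then y $ i * (M $ i \<bullet> z) else 0)"
    by (rule sum.cong) (auto simp: z)
  also have "\<dots> = y $ i * (M $ i \<bullet> z)" by simp
  finally have yi: "y $ i = 0" using z(2) by simp
  have "(\<Sum>j\<in>UNIV. y $ j *\<^sub>R (M0 $ j)) = (\<Sum>j\<in>UNIV. y $ j *\<^sub>R (M $ j))"
  proof (rule sum.cong)
    fix j show "y $ j *\<^sub>R (M0 $ j) = y $ j *\<^sub>R (M $ j)"
      using same yi by (cases "j = i") auto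
  qed simp
  then have "transpose M0 *v y = 0"
    using comb by (simp add: vec_eq_iff matrix_vector_mult_def transpose_def mult.commute)
  then have "det (transpose M0) = 0" using y(1) det_0_iff_kernel by blast
  then show False using M0 by simp
qed

section \<open>Stable tropical intersections\<close>

text \<open>
  The index \<open>i0\<close> is a slot reserved for a linear functional \<open>l\<close>; the other slots hold edge directions
  \<open>p j - q j\<close>. Fixing the size of the matrix by the type of coordinates makes the independence of
  all these vectors a single determinant.
\<close>

definition edge_matrix :: "'n \<Rightarrow> real^'n \<Rightarrow> ('n \<Rightarrow> real^'n) \<Rightarrow> ('n \<Rightarrow> real^'n) \<Rightarrow> real^'n^'n::finite"
  where "edge_matrix i0 l p q = (\<chi> j. if j = i0 then l else p j - q j)"

definition has_transversal :: "'n \<Rightarrow> real^'n \<Rightarrow> ('n::finite \<Rightarrow> (real^'n) set) \<Rightarrow> bool"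
  where "has_transversal i0 l A \<longleftrightarrow>
    (\<exists>p q. (\<forall>j. j \<noteq> i0 \<longrightarrow> p j \<in> A j \<and> q j \<in> A j) \<and> det (edge_matrix i0 l p q) \<noteq> 0)"

text \<open>
  For the tropical polynomial with exponents \<open>A j\<close> and coefficients \<open>h j\<close>, these are the exponents of
  the monomials that attain the minimum at \<open>x\<close>. The exponents need not be integral. With \<open>h = 0\<close> this
  is the initial form in direction \<open>x\<close>.
\<close>

definition active :: "('i \<Rightarrow> 'a::real_inner set) \<Rightarrow> ('i \<Rightarrow> 'a \<Rightarrow> real) \<Rightarrow> 'a \<Rightarrow> 'i \<Rightarrow> 'a set"
  where "active A h x j = {a \<in> A j. \<forall>b\<in>A j. h j a + a \<bullet> x \<le> h j b + b \<bullet> x}"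

lemma active_subset: "active A h x j \<subseteq> A j"
  by (auto simp: active_def)

lemma active_ties: "a \<in> active A h x j \<Longrightarrow> b \<in> active A h x j \<Longrightarrow> h j a + a \<bullet> x = h j b + b \<bullet> x"
  by (force simp: active_def)

lemma has_transversal_mono:
  assumes "has_transversal i0 l A" "\<And>j. j \<noteq> i0 \<Longrightarrow> A j \<subseteq> B j"
  shows "has_transversal i0 l B"
  using assms unfolding has_transversal_def by (metis subsetD)

text \<open>
  Near \<open>x\<close> only the monomials active at \<open>x\<close> compete, and along \<open>x + e w\<close> they are compared by their
  slopes in direction \<open>w\<close>.
\<close>

lemma active_perturb:
  fixes A :: "'i \<Rightarrow> 'a::real_inner set"
  assumes J: "finite J" and fin: "\<And>j. j \<in> J \<Longrightarrow> finite (A j)"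
  shows "eventually (\<lambda>e. \<forall>j\<in>J. active (active A h x) (\<lambda>_ _. 0) w j \<subseteq> active A h (x + e *\<^sub>R w) j) (at_right 0)"
proof -
  have one: "eventually (\<lambda>e. a \<in> active (active A h x) (\<lambda>_ _. 0) w j \<longrightarrow>
      h j a + a \<bullet> (x + e *\<^sub>R w) \<le> h j b + b \<bullet> (x + e *\<^sub>R w)) (at_right 0)"
    if ab: "a \<in> A j" "b \<in> A j" for a b j
  proof (cases "a \<in> active A h x j")
    case False
    then have "a \<notin> active (active A h x) (\<lambda>_ _. 0) w j" using active_subset[of "active A h x"] by blast
    then show ?thesis by simp
  next
    case a: True
    show ?thesis
    proof (cases "b \<in> active A h x j")
      case True
      have "eventually (\<lambda>e. e > (0::real)) (at_right 0)" by (simp add: eventually_at_right_less)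
      then show ?thesis
      proof eventually_elim
        case (elim e)
        show ?case
        proof
          assume "a \<in> active (active A h x) (\<lambda>_ _. 0) w j"
          then have "a \<bullet> w \<le> b \<bullet> w" using True by (auto simp: active_def[of "active A h x"])
          then have "e * (a \<bullet> w) \<le> e * (b \<bullet> w)" using elim by simp
          then show "h j a + a \<bullet> (x + e *\<^sub>R w) \<le> h j b + b \<bullet> (x + e *\<^sub>R w)"
            using active_ties[OF a True] by (simp add: inner_add_right)
        qed
      qed
    next
      case False
      then obtain c where "c \<in> A j" "h j b + b \<bullet> x > h j c + c \<bullet> x"
        using ab by (auto simp: active_def not_le)
      then have lt: "h j a + a \<bullet> x < h j b + b \<bullet> x" using a by (force simp: active_def)
      have "((\<lambda>e. (h j b + b \<bullet> (x + e *\<^sub>R w)) - (h j a + a \<bullet> (x + e *\<^sub>R w))) \<longlongrightarrow>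
          (h j b + b \<bullet> (x + 0 *\<^sub>R w)) - (h j a + a \<bullet> (x + 0 *\<^sub>R w))) (at_right 0)"
        by (intro tendsto_intros)
      then have "eventually (\<lambda>e. (h j b + b \<bullet> (x + e *\<^sub>R w)) - (h j a + a \<bullet> (x + e *\<^sub>R w)) > 0) (at_right 0)"
        using lt by (intro order_tendstoD(1)) auto
      then show ?thesis by eventually_elim auto
    qed
  qed
  have "eventually (\<lambda>e. \<forall>j\<in>J. \<forall>a\<in>A j. \<forall>b\<in>A j. a \<in> active (active A h x) (\<lambda>_ _. 0) w j \<longrightarrow>
      h j a + a \<bullet> (x + e *\<^sub>R w) \<le> h j b + b \<bullet> (x + e *\<^sub>R w)) (at_right 0)"
    by (intro eventually_ball_finite ballI one J fin)
  then show ?thesis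
  proof eventually_elim
    case (elim e)
    show ?case
    proof (intro ballI subsetI)
      fix j a assume ja: "j \<in> J" "a \<in> active (active A h x) (\<lambda>_ _. 0) w j"
      then have "a \<in> A j" using active_subset[of "active A h x" "\<lambda>_ _. 0" w j] active_subset[of A h x j] by blast
      then show "a \<in> active A h (x + e *\<^sub>R w) j"
        using elim ja by (auto simp: active_def[of A])
    qed
  qed
qed

lemma closed_Collect_ball:
  assumes "\<And>b. b \<in> B \<Longrightarrow> closed {s. P b s}"
  shows "closed {s. \<forall>b\<in>B. P b s}"
  using assms by (simp add: Collect_ball_eq closed_INT)

text \<open>
  For a fixed choice of active edges, independent together with \<open>l\<close>, the ties between the edge ends
  are \<open>n - 1\<close> independent equations. They cut out a line on which \<open>l\<close> is a coordinate, and the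
  remaining inequalities leave a closed interval on it. If this interval were unbounded above, the
  direction of the line would be a recession direction with the same edges active, contrary to
  \<open>no_ray\<close>. So the values of \<open>l\<close> form a finite union of closed sets bounded above.
\<close>

lemma transversal_max:
  fixes A :: "'n::finite \<Rightarrow> (real^'n) set"
  assumes fin: "\<And>j. j \<noteq> i0 \<Longrightarrow> finite (A j)"
    and x0: "has_transversal i0 l (active A h x0)"
    and no_ray: "\<And>w. l \<bullet> w > 0 \<Longrightarrow> \<not> has_transversal i0 l (active A (\<lambda>_ _. 0) w)"
  obtains x where "has_transversal i0 l (active A h x)"
    "\<And>y. has_transversal i0 l (active A h y) \<Longrightarrow> l \<bullet> y \<le> l \<bullet> x"
proof -
  \<comment> \<open>The choices are restricted to the slots other than \<open>i0\<close>, so that there are finitely many of them.\<close>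
  define E where "E = {(p, q). p \<in> PiE (-{i0}) A \<and> q \<in> PiE (-{i0}) A \<and> det (edge_matrix i0 l p q) \<noteq> 0}"
  have finE: "finite E"
    by (rule finite_subset[of _ "PiE (-{i0}) A \<times> PiE (-{i0}) A"])
       (auto simp: E_def intro!: finite_PiE fin)
  define T where "T = (\<lambda>(p, q). {l \<bullet> x | x. \<forall>j. j \<noteq> i0 \<longrightarrow> p j \<in> active A h x j \<and> q j \<in> active A h x j})"
  have cell: "closed (T e) \<and> bdd_above (T e)" if e: "e \<in> E" for e
  proof -
    obtain p q where pq: "e = (p, q)" by force
    have pA: "p j \<in> A j" "q j \<in> A j" if "j \<noteq> i0" for j
      using e that by (auto simp: E_def pq PiE_iff)
    have det: "det (edge_matrix i0 l p q) \<noteq> 0" using e by (auto simp: E_def pq)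
    \<comment> \<open>The points with these ties are \<open>c + s w\<close>, where \<open>s\<close> is the value of \<open>l\<close>.\<close>
    obtain c where c0: "\<And>j. edge_matrix i0 l p q $ j \<bullet> c = (if j = i0 then 0 else h j (q j) - h j (p j))"
      using det_nz_solve[OF det, of "\<lambda>j. if j = i0 then 0 else h j (q j) - h j (p j)"] by metis
    obtain w where w0: "\<And>j. edge_matrix i0 l p q $ j \<bullet> w = (if j = i0 then 1 else 0)"
      using det_nz_solve[OF det, of "\<lambda>j. if j = i0 then 1 else 0"] by metis
    have c: "l \<bullet> c = 0" using c0[of i0] by (simp add: edge_matrix_def)
    have c': "p j \<bullet> c - q j \<bullet> c = h j (q j) - h j (p j)" if "j \<noteq> i0" for j
      using c0[of j] that by (simp add: edge_matrix_def inner_diff_left)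
    have w: "l \<bullet> w = 1" using w0[of i0] by (simp add: edge_matrix_def)
    have w': "p j \<bullet> w = q j \<bullet> w" if "j \<noteq> i0" for j
      using w0[of j] that by (simp add: edge_matrix_def inner_diff_left)
    have line: "x = c + (l \<bullet> x) *\<^sub>R w"
      if "\<forall>j. j \<noteq> i0 \<longrightarrow> p j \<in> active A h x j \<and> q j \<in> active A h x j" for x
    proof -
      have "edge_matrix i0 l p q $ j \<bullet> (x - (c + (l \<bullet> x) *\<^sub>R w)) = 0" for j
      proof (cases "j = i0")
        case True
        then show ?thesis by (simp add: edge_matrix_def inner_diff_right inner_add_right c w)
      next
        case False
        then have "h j (p j) + p j \<bullet> x = h j (q j) + q j \<bullet> x" using that active_ties[of "p j" A h x j "q j"] by simp
        then show ?thesis using False c'[OF False] w'[OF False]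
          by (simp add: edge_matrix_def inner_diff_right inner_add_right inner_diff_left)
      qed
      then show ?thesis using det_nz_kernel[OF det] by (metis eq_iff_diff_eq_0)
    qed
    have T_eq: "T e = {s. \<forall>j\<in>-{i0}. \<forall>b\<in>A j. h j (p j) + p j \<bullet> (c + s *\<^sub>R w) \<le> h j b + b \<bullet> (c + s *\<^sub>R w) \<and>
          h j (q j) + q j \<bullet> (c + s *\<^sub>R w) \<le> h j b + b \<bullet> (c + s *\<^sub>R w)}" (is "_ = ?R")
    proof (intro equalityI subsetI)
      fix s assume "s \<in> T e"
      then obtain x where x: "s = l \<bullet> x" "\<forall>j. j \<noteq> i0 \<longrightarrow> p j \<in> active A h x j \<and> q j \<in> active A h x j"
        by (auto simp: T_def pq)
      then have "x = c + s *\<^sub>R w" using line by simp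
      with x show "s \<in> ?R" by (auto simp: active_def)
    next
      fix s assume "s \<in> ?R"
      moreover have "s = l \<bullet> (c + s *\<^sub>R w)" by (simp add: inner_add_right c w)
      ultimately show "s \<in> T e" using pA unfolding T_def pq active_def
        by (auto intro!: exI[of _ "c + s *\<^sub>R w"])
    qed
    have "closed (T e)" unfolding T_eq ball_conj_distrib[symmetric]
      by (intro closed_Collect_ball closed_Collect_conj closed_Collect_le continuous_intros)
    moreover have "bdd_above (T e)"
    proof (rule ccontr)
      assume "\<not> bdd_above (T e)"
      then have unb: "\<exists>t\<in>T e. t > s" for s
        by (meson bdd_aboveI not_le)
      have le: "p j \<bullet> w \<le> b \<bullet> w" if jb: "j \<noteq> i0" "b \<in> A j" for j b
      proof (rule ccontr)
        assume "\<not> ?thesis"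
        then have pos: "p j \<bullet> w - b \<bullet> w > 0" by simp
        obtain t where t: "t \<in> T e" "t > (h j b + b \<bullet> c - h j (p j) - p j \<bullet> c) / (p j \<bullet> w - b \<bullet> w)"
          using unb by blast
        from t(2) pos have "t * (p j \<bullet> w - b \<bullet> w) > h j b + b \<bullet> c - h j (p j) - p j \<bullet> c"
          by (simp add: pos_divide_less_eq)
        moreover have "h j (p j) + p j \<bullet> (c + t *\<^sub>R w) \<le> h j b + b \<bullet> (c + t *\<^sub>R w)"
          using t(1) jb unfolding T_eq by auto
        ultimately show False by (simp add: algebra_simps)
      qed
      have "has_transversal i0 l (active A (\<lambda>_ _. 0) w)"
        unfolding has_transversal_def using det pA le w'
        by (intro exI[of _ p] exI[of _ q]) (auto simp: active_def)
      then show False using no_ray[of w] w by simp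
    qed
    ultimately show ?thesis by blast
  qed
  define Y where "Y = (\<Union>e\<in>E. T e)"
  have Y_iff: "s \<in> Y \<longleftrightarrow> (\<exists>x. s = l \<bullet> x \<and> has_transversal i0 l (active A h x))" for s
  proof
    assume "s \<in> Y"
    then show "\<exists>x. s = l \<bullet> x \<and> has_transversal i0 l (active A h x)"
      unfolding Y_def E_def T_def has_transversal_def by blast
  next
    assume "\<exists>x. s = l \<bullet> x \<and> has_transversal i0 l (active A h x)"
    then obtain x p q where x: "s = l \<bullet> x" "\<And>j. j \<noteq> i0 \<Longrightarrow> p j \<in> active A h x j \<and> q j \<in> active A h x j"
      "det (edge_matrix i0 l p q) \<noteq> 0" unfolding has_transversal_def by blast
    let ?p = "restrict p (-{i0})" and ?q = "restrict q (-{i0})"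
    have "edge_matrix i0 l ?p ?q = edge_matrix i0 l p q"
      by (simp add: edge_matrix_def vec_eq_iff)
    moreover have "?p \<in> PiE (-{i0}) A" "?q \<in> PiE (-{i0}) A"
      using x(2) active_subset[of A h x] by (auto simp: PiE_iff subset_iff)
    ultimately have "(?p, ?q) \<in> E" using x(3) by (simp add: E_def)
    moreover have "s \<in> T (?p, ?q)" using x(1,2) by (auto simp: T_def)
    ultimately show "s \<in> Y" unfolding Y_def by blast
  qed
  have "closed Y" "bdd_above Y" unfolding Y_def using cell finE by auto
  moreover have "Y \<noteq> {}" using x0 Y_iff by blast
  ultimately have "Sup Y \<in> Y" by (intro closed_contains_Sup)
  then obtain x where x: "Sup Y = l \<bullet> x" "has_transversal i0 l (active A h x)" using Y_iff by blast
  show ?thesis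
  proof
    show "has_transversal i0 l (active A h x)" by fact
    fix y assume "has_transversal i0 l (active A h y)"
    then have "l \<bullet> y \<in> Y" using Y_iff by blast
    then show "l \<bullet> y \<le> l \<bullet> x" using x(1) cSup_upper[OF _ \<open>bdd_above Y\<close>] by metis
  qed
qed

text \<open>
  This is the existence of a stable intersection point of tropical hypersurfaces whose supports
  contain independent edges. The proof is by induction on the number of monomials. Suppose that there
  is no such \<open>w\<close>.

  If some \<open>A i\<close> has a monomial \<open>c\<close> besides the ends of its edge, raise the coefficient of \<open>c\<close> by 1. The
  origin then satisfies the required ties without \<open>c\<close>, and one can move along the stable
  intersection so as to increase \<open>l\<close> up to a point \<open>x\<close> where \<open>l\<close> is maximal. If some monomial were
  inactive at \<open>x\<close>, the induction hypothesis for the active monomials would give a direction of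
  further increase. So every polynomial has all its monomials tied at \<open>x\<close>, and \<open>l x > 0\<close>. In terms of
  the original fan, all exponents of each \<open>A j\<close> agree on \<open>x\<close>, except that \<open>c\<close> is smaller by 1.

  Applying this to two different monomials \<open>c\<close> and \<open>v\<close> of \<open>A i\<close> gives points \<open>xc\<close> and \<open>xv\<close>. On
  \<open>xc + xv\<close> the minimum over \<open>A i\<close> is attained precisely at \<open>c\<close> and \<open>v\<close>, and \<open>c - v\<close> is again
  independent of the other edges and \<open>l\<close>, which contradicts the assumption.
\<close>

theorem fan_transversal_positive:
  fixes A :: "'n::finite \<Rightarrow> (real^'n) set"
  assumes "\<And>j. j \<noteq> i0 \<Longrightarrow> finite (A j)" "has_transversal i0 l A"
  shows "\<exists>w. l \<bullet> w > 0 \<and> has_transversal i0 l (active A (\<lambda>_ _. 0) w)"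
  using assms
proof (induction "\<Sum>j\<in>-{i0}. card (A j)" arbitrary: A rule: less_induct)
  case less
  note fin = less.prems(1)
  show ?case
  proof (rule ccontr)
    assume "\<not> ?thesis"
    then have no_ray: "\<not> has_transversal i0 l (active A (\<lambda>_ _. 0) w)" if "l \<bullet> w > 0" for w
      using that by blast
    have all_active: "active A h x j = A j"
      if x: "has_transversal i0 l (active A h x)"
        "\<And>y. has_transversal i0 l (active A h y) \<Longrightarrow> l \<bullet> y \<le> l \<bullet> x" and j: "j \<noteq> i0" for h x j
    proof (rule ccontr)
      let ?B = "active A h x"
      assume "?B j \<noteq> A j"
      then have "?B j \<subset> A j" using active_subset[of A h x j] by blast
      then have "(\<Sum>j\<in>-{i0}. card (?B j)) < (\<Sum>j\<in>-{i0}. card (A j))"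
        using j fin active_subset[of A h x]
        by (intro sum_strict_mono_ex1) (auto intro!: card_mono psubset_card_mono bexI[of _ j])
      moreover have "finite (?B j)" if "j \<noteq> i0" for j
        using fin[OF that] active_subset[of A h x j] finite_subset by blast
      ultimately obtain w where w: "l \<bullet> w > 0" "has_transversal i0 l (active ?B (\<lambda>_ _. 0) w)"
        using less.hyps[of ?B] x(1) by blast
      have "eventually (\<lambda>e. \<forall>j\<in>-{i0}. active ?B (\<lambda>_ _. 0) w j \<subseteq> active A h (x + e *\<^sub>R w) j) (at_right 0)"
        by (rule active_perturb) (use fin in auto)
      then have "eventually (\<lambda>e. (\<forall>j\<in>-{i0}. active ?B (\<lambda>_ _. 0) w j \<subseteq> active A h (x + e *\<^sub>R w) j) \<and> e > 0) (at_right 0)"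
        by (rule eventually_conj) (rule eventually_at_right_less)
      then obtain e :: real where e: "e > 0" "\<forall>j\<in>-{i0}. active ?B (\<lambda>_ _. 0) w j \<subseteq> active A h (x + e *\<^sub>R w) j"
        using eventually_happens'[OF trivial_limit_at_right_real] by blast
      then have "has_transversal i0 l (active A h (x + e *\<^sub>R w))"
        by (intro has_transversal_mono[OF w(2)]) auto
      then have "l \<bullet> (x + e *\<^sub>R w) \<le> l \<bullet> x" by (rule x(2))
      then show False using e(1) w(1) by (simp add: inner_add_right mult_le_0_iff)
    qed
    have raise: "\<exists>x. l \<bullet> x > 0 \<and> (\<forall>j a b. j \<noteq> i0 \<longrightarrow> j \<noteq> i \<longrightarrow> a \<in> A j \<longrightarrow> b \<in> A j \<longrightarrow> a \<bullet> x = b \<bullet> x) \<and>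
        (\<forall>a\<in>A i. a \<noteq> c \<longrightarrow> a \<bullet> x = c \<bullet> x + 1)"
      if pq: "\<And>j. j \<noteq> i0 \<Longrightarrow> p j \<in> A j \<and> q j \<in> A j" "det (edge_matrix i0 l p q) \<noteq> 0"
        and i: "i \<noteq> i0" "c \<in> A i" "c \<noteq> p i" "c \<noteq> q i" for p q i c
    proof -
      define h :: "'n \<Rightarrow> real^'n \<Rightarrow> real" where "h = (\<lambda>j a. if j = i \<and> a = c then 1 else 0)"
      have start: "has_transversal i0 l (active A h 0)"
        unfolding has_transversal_def using pq i
        by (intro exI[of _ p] exI[of _ q]) (auto simp: active_def h_def)
      obtain x where x: "has_transversal i0 l (active A h x)"
        "\<And>y. has_transversal i0 l (active A h y) \<Longrightarrow> l \<bullet> y \<le> l \<bullet> x"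
        using transversal_max[OF fin start no_ray] by blast
      have tie: "h j a + a \<bullet> x = h j b + b \<bullet> x" if "j \<noteq> i0" "a \<in> A j" "b \<in> A j" for j a b
        using all_active[OF x] that active_ties by metis
      have "l \<bullet> x > 0"
      proof (rule ccontr)
        assume "\<not> ?thesis"
        then have "l \<bullet> y \<le> l \<bullet> 0" if "has_transversal i0 l (active A h y)" for y
          using x(2)[OF that] by simp
        from all_active[OF start this i(1)] have "c \<in> active A h 0 i" using i by simp
        then have "h i c + c \<bullet> 0 \<le> h i (p i) + p i \<bullet> 0" using pq(1)[OF i(1)] by (simp add: active_def)
        then show False using i by (simp add: h_def)
      qed
      moreover have "a \<bullet> x = b \<bullet> x" if "j \<noteq> i0" "j \<noteq> i" "a \<in> A j" "b \<in> A j" for j a b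
        using tie[of j a b] that by (simp add: h_def)
      moreover have "a \<bullet> x = c \<bullet> x + 1" if "a \<in> A i" "a \<noteq> c" for a
        using tie[of i a c] that i by (simp add: h_def)
      ultimately show ?thesis by blast
    qed
    obtain p q where pq: "\<And>j. j \<noteq> i0 \<Longrightarrow> p j \<in> A j \<and> q j \<in> A j" and det: "det (edge_matrix i0 l p q) \<noteq> 0"
      using less.prems(2) unfolding has_transversal_def by blast
    show False
    proof (cases "\<exists>i c. i \<noteq> i0 \<and> c \<in> A i \<and> c \<noteq> p i \<and> c \<noteq> q i")
      case False
      \<comment> \<open>Every \<open>A j\<close> is just \<open>{p j, q j}\<close>, so any \<open>w\<close> on which these ties hold will do.\<close>
      obtain w where w: "\<And>j. edge_matrix i0 l p q $ j \<bullet> w = (if j = i0 then 1 else 0)"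
        using det_nz_solve[OF det, of "\<lambda>j. if j = i0 then 1 else 0"] by metis
      have lw: "l \<bullet> w = 1" using w[of i0] by (simp add: edge_matrix_def)
      have tie: "p j \<bullet> w = q j \<bullet> w" if "j \<noteq> i0" for j
        using w[of j] that by (simp add: edge_matrix_def inner_diff_left)
      have "p j \<in> active A (\<lambda>_ _. 0) w j \<and> q j \<in> active A (\<lambda>_ _. 0) w j" if "j \<noteq> i0" for j
      proof -
        have "A j = {p j, q j}" using False pq[OF that] that by blast
        then show ?thesis using tie[OF that] by (auto simp: active_def)
      qed
      then have "has_transversal i0 l (active A (\<lambda>_ _. 0) w)"
        unfolding has_transversal_def using det by blast
      then show False using no_ray lw by simp
    next
      case True
      then obtain i c where i: "i \<noteq> i0" and c: "c \<in> A i" "c \<noteq> p i" "c \<noteq> q i" by blast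
      \<comment> \<open>Since \<open>z\<close> separates \<open>p i\<close> from \<open>q i\<close>, it separates one of them, called \<open>u\<close> below, from \<open>c\<close>; so
        the edge from \<open>c\<close> to \<open>u\<close> is independent of the rest and avoids the other end \<open>v\<close>, which can be raised too.\<close>
      obtain z where z: "\<And>j. edge_matrix i0 l p q $ j \<bullet> z = (if j = i then 1 else 0)"
        using det_nz_solve[OF det, of "\<lambda>j. if j = i then 1 else 0"] by metis
      have zi: "p i \<bullet> z - q i \<bullet> z = 1" using z[of i] i by (simp add: edge_matrix_def inner_diff_left)
      obtain xc where xc: "l \<bullet> xc > 0" "\<forall>j a b. j \<noteq> i0 \<longrightarrow> j \<noteq> i \<longrightarrow> a \<in> A j \<longrightarrow> b \<in> A j \<longrightarrow> a \<bullet> xc = b \<bullet> xc"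
         "\<forall>a\<in>A i. a \<noteq> c \<longrightarrow> a \<bullet> xc = c \<bullet> xc + 1" using raise[OF pq det i c] by metis
      have step: False if uv: "u \<in> A i" "v \<in> A i" "u \<noteq> v" "v \<noteq> c" and uz: "(u - c) \<bullet> z \<noteq> 0" for u v
      proof -
        let ?p = "p(i := u)" and ?q = "q(i := c)"
        have "det (edge_matrix i0 l ?p ?q) \<noteq> 0"
        proof (rule det_replace_row[OF det, of i _ z])
          fix j assume j: "j \<noteq> i"
          show same: "edge_matrix i0 l ?p ?q $ j = edge_matrix i0 l p q $ j" using j by (simp add: edge_matrix_def)
          show "edge_matrix i0 l ?p ?q $ j \<bullet> z = 0" unfolding same using z[of j] j by simp
        qed (use i uz in \<open>simp add: edge_matrix_def\<close>)
        moreover have "?p j \<in> A j \<and> ?q j \<in> A j" if "j \<noteq> i0" for j using pq[OF that] uv(1) c(1) by simp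
        ultimately have "\<exists>x. l \<bullet> x > 0 \<and> (\<forall>j a b. j \<noteq> i0 \<longrightarrow> j \<noteq> i \<longrightarrow> a \<in> A j \<longrightarrow> b \<in> A j \<longrightarrow> a \<bullet> x = b \<bullet> x) \<and>
            (\<forall>a\<in>A i. a \<noteq> v \<longrightarrow> a \<bullet> x = v \<bullet> x + 1)"
          by (intro raise[of ?p ?q i v]) (use uv i in simp_all)
        then obtain xv where xv: "l \<bullet> xv > 0" "\<forall>j a b. j \<noteq> i0 \<longrightarrow> j \<noteq> i \<longrightarrow> a \<in> A j \<longrightarrow> b \<in> A j \<longrightarrow> a \<bullet> xv = b \<bullet> xv"
           "\<forall>a\<in>A i. a \<noteq> v \<longrightarrow> a \<bullet> xv = v \<bullet> xv + 1"
          by blast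
        define x where "x = xc + xv"
        let ?p' = "p(i := c)" and ?q' = "q(i := v)"
        \<comment> \<open>A combination that \<open>l\<close> and the remaining edges annihilate, while
          \<open>c - v\<close>, being \<open>- 1\<close> on \<open>xc\<close> and \<open>1\<close> on \<open>xv\<close>, is negative on it.\<close>
        define z' where "z' = (l \<bullet> xv) *\<^sub>R xc - (l \<bullet> xc) *\<^sub>R xv"
        have "(c - v) \<bullet> z' = - (l \<bullet> xv) - (l \<bullet> xc)"
          using xc(3) xv(3) uv c by (simp add: z'_def inner_diff_left inner_diff_right algebra_simps)
        then have cv: "(c - v) \<bullet> z' \<noteq> 0" using xc(1) xv(1) by linarith
        have "det (edge_matrix i0 l ?p' ?q') \<noteq> 0"
        proof (rule det_replace_row[OF det, of i _ z'])
          fix j assume j: "j \<noteq> i"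
          show "edge_matrix i0 l ?p' ?q' $ j = edge_matrix i0 l p q $ j" using j by (simp add: edge_matrix_def)
          show "edge_matrix i0 l ?p' ?q' $ j \<bullet> z' = 0"
          proof (cases "j = i0")
            case True
            then show ?thesis by (simp add: edge_matrix_def z'_def inner_diff_right)
          next
            case False
            then have "p j \<bullet> xc = q j \<bullet> xc" "p j \<bullet> xv = q j \<bullet> xv"
              using xc(2) xv(2) pq j by blast+
            then show ?thesis using False j by (simp add: edge_matrix_def z'_def inner_diff_right inner_diff_left)
          qed
        qed (use i cv in \<open>simp add: edge_matrix_def\<close>)
        moreover have "?p' j \<in> active A (\<lambda>_ _. 0) x j \<and> ?q' j \<in> active A (\<lambda>_ _. 0) x j" if j: "j \<noteq> i0" for j
        proof (cases "j = i")
          case True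
          have "c \<bullet> x = v \<bullet> x" using xc(3) xv(3) uv c by (simp add: x_def inner_add_right)
          moreover have "v \<bullet> x \<le> a \<bullet> x" if "a \<in> A i" for a
          proof -
            have "c \<bullet> xc \<le> a \<bullet> xc" "v \<bullet> xv \<le> a \<bullet> xv" "a \<noteq> v \<Longrightarrow> v \<bullet> xv + 1 = a \<bullet> xv" "v \<bullet> xc = c \<bullet> xc + 1"
              using xc(3)[rule_format, of a] xv(3)[rule_format, of a] xc(3)[rule_format, of v] that uv
              by (cases "a = c"; cases "a = v"; simp)+
            then show ?thesis unfolding x_def inner_add_right by (cases "a = v") simp_all
          qed
          ultimately show ?thesis using True uv c by (simp add: active_def)
        next
          case False
          then have "a \<bullet> xc = b \<bullet> xc" "a \<bullet> xv = b \<bullet> xv" if "a \<in> A j" "b \<in> A j" for a b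
            using xc(2) xv(2) j that by blast+
          then have "a \<bullet> x \<le> b \<bullet> x" if "a \<in> A j" "b \<in> A j" for a b
            using that unfolding x_def inner_add_right by (metis order.refl)
          then show ?thesis using False pq[OF j] by (auto simp: active_def)
        qed
        ultimately have "has_transversal i0 l (active A (\<lambda>_ _. 0) x)" unfolding has_transversal_def by blast
        moreover have "l \<bullet> x > 0" using xc(1) xv(1) by (simp add: x_def inner_add_right)
        ultimately show False using no_ray by blast
      qed
      have "(p i - c) \<bullet> z \<noteq> 0 \<or> (q i - c) \<bullet> z \<noteq> 0" using zi by (auto simp: inner_diff_left)
      moreover have "p i \<noteq> q i" using zi by auto
      ultimately show False using step[of "p i" "q i"] step[of "q i" "p i"] pq[OF i] c by auto
    qed
  qed
qed

text \<open>
  The assumption \<open>isol\<close> says that the tropical hypersurfaces with zero coefficients and exponents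
  \<open>A i\<close> meet only in the origin. A maximal partial transversal is stored as a full basis \<open>e\<close>, of which
  only the members with index in \<open>S\<close> come from the sets \<open>A i\<close>. The other members, except one that
  serves as the functional \<open>l\<close>, become the binomials with exponents \<open>0\<close> and \<open>e j\<close>. Stability of the
  resulting \<open>w\<close> is what makes maximality usable: a vector of an unmatched \<open>A i - A i\<close> that is not
  orthogonal to \<open>w\<close> would be independent of the new edges and would enlarge the transversal.
\<close>

theorem transversal_if_isolated:
  fixes A :: "'i \<Rightarrow> (real^'n::finite) set"
  assumes fin: "\<And>i. i \<in> K \<Longrightarrow> finite (A i)"
    and two: "\<And>i. i \<in> K \<Longrightarrow> \<exists>a\<in>A i. \<exists>b\<in>A i. a \<noteq> b"
    and isol: "\<And>v. (\<And>i. i \<in> K \<Longrightarrow> \<exists>a\<in>active A (\<lambda>_ _. 0) v i. \<exists>b\<in>active A (\<lambda>_ _. 0) v i. a \<noteq> b) \<Longrightarrow> v = 0"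
  obtains \<sigma> p q where "inj \<sigma>" "range \<sigma> \<subseteq> K" "\<And>j. p j \<in> A (\<sigma> j)" "\<And>j. q j \<in> A (\<sigma> j)"
    "det (\<chi> j. p j - q j) \<noteq> 0"
proof -
  define P where "P = (\<lambda>S::'n set. \<exists>\<sigma> e. inj_on \<sigma> S \<and> \<sigma> ` S \<subseteq> K \<and>
    (\<forall>j\<in>S. \<exists>a\<in>A (\<sigma> j). \<exists>b\<in>A (\<sigma> j). e j = a - b) \<and> det (\<chi> j. (e j :: real^'n)) \<noteq> 0)"
  have "(\<chi> j. (axis j 1 :: real^'n)) = mat 1" by (simp add: mat_def axis_def vec_eq_iff)
  then have "P {}" unfolding P_def by (intro exI[of _ undefined] exI[of _ "\<lambda>j. axis j 1"]) simp
  moreover have "\<forall>S. P S \<longrightarrow> card S < Suc CARD('n)" by (simp add: card_mono less_Suc_eq_le)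
  ultimately have "\<exists>S. P S \<and> (\<forall>S'. P S' \<longrightarrow> card S' \<le> card S)"
    by (rule ex_has_greatest_nat)
  then obtain S where "P S" and max: "\<And>S'. P S' \<Longrightarrow> card S' \<le> card S"
    by blast
  then obtain \<sigma> e where \<sigma>: "inj_on \<sigma> S" "\<sigma> ` S \<subseteq> K" and e: "\<And>j. j \<in> S \<Longrightarrow> \<exists>a\<in>A (\<sigma> j). \<exists>b\<in>A (\<sigma> j). e j = a - b"
    and det: "det (\<chi> j. (e j :: real^'n)) \<noteq> 0" unfolding P_def by blast
  have "S = UNIV"
  proof (rule ccontr)
    assume "S \<noteq> UNIV"
    then obtain i0 where i0: "i0 \<notin> S" by blast
    define B where "B = (\<lambda>j. if j \<in> S then A (\<sigma> j) else {0, e j})"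
    obtain a b where ab: "\<And>j. j \<in> S \<Longrightarrow> a j \<in> A (\<sigma> j) \<and> b j \<in> A (\<sigma> j) \<and> e j = a j - b j" using e by metis
    let ?p = "\<lambda>j. if j \<in> S then a j else e j" and ?q = "\<lambda>j. if j \<in> S then b j else 0"
    have "edge_matrix i0 (e i0) ?p ?q = (\<chi> j. e j)" using ab by (simp add: edge_matrix_def vec_eq_iff)
    then have "has_transversal i0 (e i0) B" unfolding has_transversal_def using ab det
      by (intro exI[of _ ?p] exI[of _ ?q]) (simp add: B_def)
    moreover have "finite (B j)" for j using fin \<sigma> by (auto simp: B_def)
    ultimately obtain w where w: "e i0 \<bullet> w > 0" "has_transversal i0 (e i0) (active B (\<lambda>_ _. 0) w)"
      using fan_transversal_positive by blast
    then obtain p q where pq: "\<And>j. j \<noteq> i0 \<Longrightarrow> p j \<in> active B (\<lambda>_ _. 0) w j \<and> q j \<in> active B (\<lambda>_ _. 0) w j"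
      and dpq: "det (edge_matrix i0 (e i0) p q) \<noteq> 0" unfolding has_transversal_def by blast
    have pqA: "p j \<in> active A (\<lambda>_ _. 0) w (\<sigma> j) \<and> q j \<in> active A (\<lambda>_ _. 0) w (\<sigma> j)" if "j \<in> S" for j
      using pq[of j] that i0 by (auto simp: active_def B_def)
    have tie: "p j \<bullet> w = q j \<bullet> w" if "j \<noteq> i0" for j using pq[OF that] active_ties[of "p j" B "\<lambda>_ _. 0" w j "q j"] by simp
    have "\<exists>a\<in>active A (\<lambda>_ _. 0) w i. \<exists>b\<in>active A (\<lambda>_ _. 0) w i. a \<noteq> b" if i: "i \<in> K" for i
    proof (cases "i \<in> \<sigma> ` S")
      case True
      then obtain j where j: "j \<in> S" "i = \<sigma> j" by blast
      then have "j \<noteq> i0" using i0 by blast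
      obtain z where "edge_matrix i0 (e i0) p q $ j \<bullet> z = 1" using det_nz_solve[OF dpq, of "\<lambda>_. 1"] by metis
      then have "p j \<noteq> q j" using \<open>j \<noteq> i0\<close> by (auto simp: edge_matrix_def)
      then show ?thesis using pqA j by blast
    next
      case False
      have all_tie: "a \<bullet> w = b \<bullet> w" if ab: "a \<in> A i" "b \<in> A i" for a b
      proof (rule ccontr)
        assume ne: "a \<bullet> w \<noteq> b \<bullet> w"
        let ?e = "\<lambda>j. if j = i0 then a - b else p j - q j"
        have "det (\<chi> j. ?e j) \<noteq> 0"
          by (rule det_replace_row[OF dpq, of i0 _ w]) (use tie ne in \<open>auto simp: edge_matrix_def inner_diff_left\<close>)
        moreover have "inj_on (\<sigma>(i0 := i)) (insert i0 S)" using \<sigma>(1) i0 False by (auto simp: inj_on_def)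
        moreover have "(\<sigma>(i0 := i)) ` (insert i0 S) \<subseteq> K" using \<sigma>(2) i i0 by auto
        moreover have "\<exists>a\<in>A ((\<sigma>(i0 := i)) j). \<exists>b\<in>A ((\<sigma>(i0 := i)) j). ?e j = a - b" if "j \<in> insert i0 S" for j
        proof (cases "j = i0")
          case False
          then have "p j \<in> A (\<sigma> j) \<and> q j \<in> A (\<sigma> j)" using pqA[of j] that by (auto simp: active_def)
          then show ?thesis using False by auto
        qed (use ab in auto)
        ultimately have "P (insert i0 S)" unfolding P_def
          by (intro exI[of _ "\<sigma>(i0 := i)"] exI[of _ ?e] conjI ballI)
        then have "card (insert i0 S) \<le> card S" by (rule max)
        then show False using i0 by simp
      qed
      have "a \<bullet> w \<le> b \<bullet> w" if "a \<in> A i" "b \<in> A i" for a b using all_tie[OF that] by simp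
      then have "active A (\<lambda>_ _. 0) w i = A i" by (auto simp: active_def)
      then show ?thesis using two[OF i] by simp
    qed
    then have "w = 0" by (rule isol)
    then show False using w(1) by simp
  qed
  moreover obtain p q where "\<And>j. j \<in> S \<Longrightarrow> p j \<in> A (\<sigma> j) \<and> q j \<in> A (\<sigma> j) \<and> e j = p j - q j" using e by metis
  ultimately show ?thesis using that[of \<sigma> p q] \<sigma> det by auto
qed

section \<open>Volumes of lattice parallelepipeds and packings\<close>

lemma emeasure_translation_lebesgue:
  "emeasure lebesgue ((+) a ` S) = emeasure lebesgue (S :: 'a::euclidean_space set)"
proof -
  have "(+) a ` S = (\<lambda>x. 1 *\<^sub>R x + a) ` S" by (simp add: add.commute)
  then show ?thesis using emeasure_lebesgue_affine[of 1 a S] by simp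
qed

text \<open>
  Cut the half-open unit cube \<open>H\<close> along the translates of \<open>S\<close> and move each piece back into \<open>S\<close>. The
  pieces then lie in different integral translates of \<open>H\<close>, so they are disjoint.
\<close>

lemma emeasure_ge_1_if_lattice_translates_cover:
  fixes S :: "(real^'n::finite) set"
  assumes S: "S \<in> sets lebesgue" and cover: "\<And>y. \<exists>m :: 'n \<Rightarrow> int. y - (\<chi> j. of_int (m j)) \<in> S"
  shows "emeasure lebesgue S \<ge> 1"
proof -
  define z :: "('n \<Rightarrow> int) \<Rightarrow> real^'n" where "z = (\<lambda>m. \<chi> j. of_int (m j))"
  define H :: "(real^'n) set" where "H = {y. \<forall>j. 0 \<le> y $ j \<and> y $ j < 1}"
  have "H = (\<Inter>j. {y. 0 \<le> y $ j} \<inter> {y. y $ j < 1})" by (auto simp: H_def)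
  also have "\<dots> \<in> sets borel"
    by (intro sets.countable_INT'' sets.Int borel_closed borel_open closed_Collect_le open_Collect_less
        continuous_intros countableI_type)
  finally have H: "H \<in> sets lebesgue" by simp
  have "inj (\<lambda>(i::int) (_::'n). i)" by (auto simp: inj_def fun_eq_iff)
  then have "infinite (UNIV :: ('n \<Rightarrow> int) set)"
    by (metis finite_imageD finite_subset infinite_UNIV_int subset_UNIV)
  then have "bij (from_nat_into (UNIV :: ('n \<Rightarrow> int) set))"
    by (intro bij_betw_from_nat_into) auto
  then obtain f :: "nat \<Rightarrow> 'n \<Rightarrow> int" where f: "bij f" by blast
  have tr: "(+) (- z (f k)) ` ((+) (z (f k)) ` S \<inter> H) = S \<inter> (+) (- z (f k)) ` H" for k
    by (force simp: image_iff algebra_simps)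
  have "box 0 1 \<subseteq> H" by (auto simp: H_def mem_box_cart less_imp_le)
  then have "emeasure lebesgue (box 0 1 :: (real^'n) set) \<le> emeasure lebesgue H" by (rule emeasure_mono) (rule H)
  moreover have one: "1 \<bullet> b = 1" if "b \<in> Basis" for b :: "real^'n"
    using that by (auto simp: Basis_vec_def inner_axis)
  have "emeasure lborel (box 0 1 :: (real^'n) set) = 1"
    by (subst emeasure_lborel_box) (auto simp: one)
  ultimately have one_le: "1 \<le> emeasure lebesgue H" by simp
  have "H \<subseteq> (\<Union>k. (+) (z (f k)) ` S \<inter> H)"
  proof
    fix y assume y: "y \<in> H"
    obtain m where "y - z m \<in> S" using cover z_def by auto
    moreover obtain k where "f k = m" using f by (metis bij_def surjD)
    ultimately show "y \<in> (\<Union>k. (+) (z (f k)) ` S \<inter> H)"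
      using y by (auto simp: image_iff intro!: exI[of _ k] bexI[of _ "y - z m"])
  qed
  then have "emeasure lebesgue H \<le> emeasure lebesgue (\<Union>k. (+) (z (f k)) ` S \<inter> H)"
    by (rule emeasure_mono) (intro sets.countable_UN'' sets.Int H lebesgue_sets_translation S countableI_type)
  also have "\<dots> \<le> (\<Sum>k. emeasure lebesgue ((+) (z (f k)) ` S \<inter> H))"
    by (intro emeasure_subadditive_countably) (auto intro!: sets.Int H lebesgue_sets_translation S)
  also have "\<dots> = (\<Sum>k. emeasure lebesgue (S \<inter> (+) (- z (f k)) ` H))"
    unfolding tr[symmetric] emeasure_translation_lebesgue ..
  also have "\<dots> = emeasure lebesgue (\<Union>k. S \<inter> (+) (- z (f k)) ` H)"
  proof (rule suminf_emeasure)
    show "range (\<lambda>k. S \<inter> (+) (- z (f k)) ` H) \<subseteq> sets lebesgue"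
      by (intro image_subsetI sets.Int H lebesgue_sets_translation S)
    show "disjoint_family (\<lambda>k. S \<inter> (+) (- z (f k)) ` H)"
      unfolding disjoint_family_on_def
    proof (intro ballI impI, rule ccontr)
      fix k k' :: nat assume "k \<noteq> k'" "S \<inter> (+) (- z (f k)) ` H \<inter> (S \<inter> (+) (- z (f k')) ` H) \<noteq> {}"
      then obtain y y' where y: "y \<in> H" "y' \<in> H" "y - z (f k) = y' - z (f k')" by auto
      have "f k j = f k' j" for j
      proof -
        have "y $ j - of_int (f k j) = y' $ j - of_int (f k' j)"
          using arg_cong[OF y(3), of "\<lambda>v. v $ j"] by (simp add: z_def)
        moreover have "0 \<le> y $ j" "y $ j < 1" "0 \<le> y' $ j" "y' $ j < 1" using y(1,2) by (auto simp: H_def)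
        ultimately show ?thesis by linarith
      qed
      then show False using f \<open>k \<noteq> k'\<close> by (metis bij_def injD ext)
    qed
  qed
  also have "\<dots> \<le> emeasure lebesgue S" by (rule emeasure_mono) (auto simp: S)
  finally show ?thesis using one_le by (rule order_trans[rotated])
qed

text \<open>
  The translates of the parallelepiped by the combinations \<open>m_i / d_i\<close> of the vectors \<open>v i\<close> with
  integers \<open>m_i\<close> cover the space. Modulo integral vectors, the translations with \<open>0 \<le> m_i < d_i\<close>
  suffice; their number is the product of the \<open>d_i\<close>, and so these translates together have volume at
  least 1.
\<close>

lemma measure_lattice_parallelepiped:
  fixes v :: "'n::finite \<Rightarrow> real^'n" and d :: "'n \<Rightarrow> nat"
  assumes int: "\<And>i j. v i $ j \<in> \<int>" and det: "det (\<chi> i. v i) \<noteq> 0" and d: "\<And>i. d i > 0"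
  shows "1 \<le> (\<Prod>i\<in>UNIV. real (d i)) *
    measure lebesgue ((\<lambda>t :: real^'n. \<Sum>i\<in>UNIV. (t $ i / real (d i)) *\<^sub>R v i) ` cbox 0 1)"
proof -
  define P where "P = (\<lambda>t :: real^'n. \<Sum>i\<in>UNIV. (t $ i / real (d i)) *\<^sub>R v i) ` cbox 0 1"
  define R where "R = PiE (UNIV::'n set) (\<lambda>i. {..<d i})"
  define u where "u = (\<lambda>r. \<Sum>i\<in>UNIV. (real (r i) / real (d i)) *\<^sub>R v i)"
  have "compact P" unfolding P_def
    by (intro compact_continuous_image compact_cbox continuous_intros) (use d in auto)
  then have lP: "P \<in> lmeasurable" by (rule lmeasurable_compact)
  have finR: "finite R" by (auto simp: R_def intro!: finite_PiE)
  have "1 \<le> emeasure lebesgue (\<Union>r\<in>R. (+) (u r) ` P)"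
  proof (rule emeasure_ge_1_if_lattice_translates_cover)
    show "(\<Union>r\<in>R. (+) (u r) ` P) \<in> sets lebesgue"
      using lP finR by (intro sets.finite_UN lebesgue_sets_translation) auto
    fix y :: "real^'n"
    have "det (transpose (\<chi> i. v i)) \<noteq> 0" using det by simp
    then obtain s where s: "\<And>j. transpose (\<chi> i. v i) $ j \<bullet> s = y $ j" using det_nz_solve by metis
    have y: "y = (\<Sum>i\<in>UNIV. s $ i *\<^sub>R v i)"
      using s by (simp add: vec_eq_iff inner_vec_def transpose_def mult.commute)
    \<comment> \<open>The coefficient of \<open>v i\<close> splits into a point of the cube, a residue modulo \<open>d i\<close>, and an integer.\<close>
    define k where "k = (\<lambda>i. \<lfloor>s $ i * d i\<rfloor>)"
    define t :: "real^'n" where "t = (\<chi> i. frac (s $ i * d i))"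
    define r where "r = (\<lambda>i. nat (k i mod int (d i)))"
    define m where "m = (\<lambda>i. k i div int (d i))"
    have split: "s $ i = t $ i / d i + real (r i) / d i + of_int (m i)" for i
    proof -
      have "int (r i) = k i mod int (d i)" using d[of i] by (simp add: r_def)
      then have "k i = int (r i) + int (d i) * m i" by (simp add: m_def)
      then have "of_int (k i) = real (r i) + real (d i) * of_int (m i)"
        by (metis of_int_add of_int_mult of_int_of_nat_eq)
      moreover have "s $ i * d i = t $ i + of_int (k i)" by (simp add: t_def k_def frac_def)
      ultimately show ?thesis using d[of i] by (simp add: field_simps)
    qed
    define g where "g = (\<Sum>i\<in>UNIV. of_int (m i) *\<^sub>R v i)"
    have "g $ j \<in> \<int>" for j by (simp add: g_def int Ints_sum Ints_mult)
    then have g: "g = (\<chi> j. of_int \<lfloor>g $ j\<rfloor>)" by (simp add: vec_eq_iff)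
    have "y = u r + (\<Sum>i\<in>UNIV. (t $ i / d i) *\<^sub>R v i) + g"
      unfolding y g_def u_def by (simp add: split scaleR_add_left sum.distrib)
    moreover have "t \<in> cbox 0 1" by (auto simp: t_def mem_box_cart less_imp_le[OF frac_lt_1])
    moreover have "r \<in> R" using d by (auto simp: R_def r_def nat_less_iff)
    ultimately have "y - g \<in> (\<Union>r\<in>R. (+) (u r) ` P)" unfolding P_def by force
    then show "\<exists>m :: 'n \<Rightarrow> int. y - (\<chi> j. of_int (m j)) \<in> (\<Union>r\<in>R. (+) (u r) ` P)"
      using g by metis
  qed
  also have "\<dots> \<le> (\<Sum>r\<in>R. emeasure lebesgue ((+) (u r) ` P))"
    using finR lP by (intro emeasure_subadditive_finite) (auto intro!: lebesgue_sets_translation)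
  also have "\<dots> = of_nat (card R) * emeasure lebesgue P" by (simp add: emeasure_translation_lebesgue)
  also have "\<dots> = ennreal (real (card R) * measure lebesgue P)"
    using lP by (simp add: emeasure_eq_measure2 ennreal_mult ennreal_of_nat_eq_real_of_nat)
  finally have "1 \<le> real (card R) * measure lebesgue P"
    by (metis ennreal_1 ennreal_le_iff measure_nonneg mult_nonneg_nonneg of_nat_0_le_iff)
  moreover have "card R = (\<Prod>i\<in>UNIV. d i)" by (simp add: R_def card_PiE)
  ultimately show ?thesis by (simp add: P_def)
qed

lemma measure_scaled_simplex:
  fixes k :: real assumes k: "k > 0"
  defines "B \<equiv> {y :: real^'n::finite. (\<forall>j. 0 \<le> y $ j) \<and> (\<Sum>j\<in>UNIV. y $ j) \<le> k}"
  shows "B \<in> lmeasurable" "bounded B" "measure lebesgue B = k ^ CARD('n) / fact CARD('n)"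
proof -
  let ?\<Delta> = "convex hull (insert 0 Basis) :: (real^'n) set"
  have \<Delta>: "?\<Delta> = {y. (\<forall>j. 0 \<le> y $ j) \<and> (\<Sum>j\<in>UNIV. y $ j) \<le> 1}"
  proof -
    have inj: "inj (\<lambda>j. axis j (1::real) :: real^'n)" by (auto simp: inj_def axis_eq_axis)
    have Basis: "(Basis :: (real^'n) set) = range (\<lambda>j. axis j 1)" by (auto simp: Basis_vec_def)
    show ?thesis by (subst std_simplex) (simp add: Basis sum.reindex[OF inj] o_def inner_axis)
  qed
  have "compact ?\<Delta>" by (intro finite_imp_compact_convex_hull) simp
  have B: "B = (\<lambda>x. k *\<^sub>R x + 0) ` ?\<Delta>"
  proof (intro equalityI subsetI)
    fix y assume "y \<in> B"
    then have "(1 / k) *\<^sub>R y \<in> ?\<Delta>" unfolding \<Delta> using k by (simp add: B_def flip: sum_divide_distrib)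
    then show "y \<in> (\<lambda>x. k *\<^sub>R x + 0) ` ?\<Delta>" using k by (intro image_eqI[of _ _ "(1 / k) *\<^sub>R y"]) auto
  qed (use k in \<open>auto simp: B_def \<Delta> simp flip: sum_distrib_left intro: mult_left_le\<close>)
  have "compact B" unfolding B by (intro compact_continuous_image continuous_intros \<open>compact ?\<Delta>\<close>)
  then show "B \<in> lmeasurable" "bounded B" by (rule lmeasurable_compact, rule compact_imp_bounded)
  have "measure lebesgue ?\<Delta> = 1 / fact CARD('n)"
    using content_std_simplex[where 'a = "real^'n"] \<open>compact ?\<Delta>\<close> by (simp add: borel_compact)
  then show "measure lebesgue B = k ^ CARD('n) / fact CARD('n)"
    unfolding B measure_lebesgue_affine using k by simp
qed

text \<open>
  If \<open>y\<close> is interior to \<open>P\<close>, the supergradient inequality at \<open>x\<close> also holds for the slope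
  \<open>y - \<delta> (x' - x)\<close>. This makes the inequality for \<open>y\<close> between \<open>x\<close> and \<open>x'\<close> strict, so the reverse
  one fails.
\<close>

lemma supergradient_cells_disjoint:
  fixes g :: "'a::real_inner \<Rightarrow> real"
  assumes P: "\<And>y z. y \<in> P \<Longrightarrow> g z \<le> g x + y \<bullet> (z - x)"
    and Q: "\<And>y z. y \<in> Q \<Longrightarrow> g z \<le> g x' + y \<bullet> (z - x')" and "x \<noteq> x'"
  shows "interior P \<inter> Q = {}"
proof (rule ccontr)
  assume "interior P \<inter> Q \<noteq> {}"
  then obtain y \<epsilon> where y: "y \<in> Q" "\<epsilon> > 0" "ball y \<epsilon> \<subseteq> P" by (auto simp: mem_interior)
  define w where "w = x' - x"
  have w: "norm w > 0" using assms(3) by (simp add: w_def)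
  define \<delta> where "\<delta> = \<epsilon> / (2 * norm w)"
  have \<delta>: "\<delta> > 0" using y w by (simp add: \<delta>_def)
  have "dist y (y - \<delta> *\<^sub>R w) < \<epsilon>" using y(2) w by (simp add: dist_norm \<delta>_def)
  then have "y - \<delta> *\<^sub>R w \<in> P" using y(3) by auto
  then have "g x' \<le> g x + (y - \<delta> *\<^sub>R w) \<bullet> w" using P unfolding w_def by blast
  moreover have "g x \<le> g x' + y \<bullet> (x - x')" using Q y(1) by blast
  moreover have "\<delta> * (w \<bullet> w) > 0" using \<delta> w by simp
  ultimately show False by (simp add: w_def inner_diff_left inner_diff_right algebra_simps)
qed

lemma convex_packing_card:
  fixes P :: "'a \<Rightarrow> 'b::euclidean_space set"
  assumes F: "finite F" and conv: "\<And>x. x \<in> F \<Longrightarrow> convex (P x)"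
    and big: "\<And>x. x \<in> F \<Longrightarrow> c \<le> measure lebesgue (P x)"
    and sub: "\<And>x. x \<in> F \<Longrightarrow> P x \<subseteq> B" and B: "B \<in> lmeasurable" "bounded B"
    and disj: "\<And>x y. x \<in> F \<Longrightarrow> y \<in> F \<Longrightarrow> x \<noteq> y \<Longrightarrow> interior (P x) \<inter> P y = {}"
  shows "real (card F) * c \<le> measure lebesgue B"
proof -
  have bdd: "bounded (P x)" if "x \<in> F" for x using sub[OF that] B(2) bounded_subset by blast
  have lm: "interior (P x) \<in> lmeasurable" if "x \<in> F" for x
    by (intro lmeasurable_interior bdd that)
  have "real (card F) * c = (\<Sum>x\<in>F. c)" by simp
  also have "\<dots> \<le> (\<Sum>x\<in>F. measure lebesgue (interior (P x)))"
  proof (rule sum_mono)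
    fix x assume x: "x \<in> F"
    then have "measure lebesgue (interior (P x)) = measure lebesgue (P x)"
      by (intro measure_interior negligible_convex_frontier conv bdd)
    then show "c \<le> measure lebesgue (interior (P x))" using big[OF x] by linarith
  qed
  also have "\<dots> = measure lebesgue (\<Union>x\<in>F. interior (P x))"
  proof (rule measure_finite_Union[symmetric])
    show "disjoint_family_on (\<lambda>x. interior (P x)) F"
      using disj interior_subset by (fastforce simp: disjoint_family_on_def)
    show "emeasure lebesgue (interior (P x)) \<noteq> \<infinity>" if "x \<in> F" for x
      using lm[OF that] by (auto simp: fmeasurable_def)
  qed (use F lm in auto)
  also have "\<dots> \<le> measure lebesgue B"
    using sub interior_subset lm F B(1)
    by (intro measure_mono_fmeasurable) (auto intro!: sets.finite_UN)
  finally show ?thesis .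
qed

section \<open>Numerical estimates\<close>

lemma power_le_fact_mult_binomial: "k ^ n \<le> fact n * ((k + n - 1) choose n)"
proof (cases k)
  case 0
  then show ?thesis by (cases n) auto
next
  case (Suc m)
  have "Suc m ^ n \<le> fact n * ((m + n) choose n)"
  proof (induction n)
    case (Suc n)
    have "Suc m ^ Suc n \<le> Suc (m + n) * (fact n * ((m + n) choose n))"
      unfolding power_Suc by (rule mult_le_mono) (use Suc in simp_all)
    also have "\<dots> = fact n * (Suc n * (Suc (m + n) choose Suc n))"
      unfolding Suc_times_binomial by (simp only: mult_ac)
    also have "\<dots> = fact (Suc n) * ((m + Suc n) choose Suc n)"
      by (simp only: fact_Suc of_nat_id mult_ac add_Suc_right)
    finally show ?case .
  qed simp
  then show ?thesis by (simp add: Suc)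
qed

lemma Suc_le_binomial: "0 < r \<Longrightarrow> r \<le> m \<Longrightarrow> Suc m \<le> Suc m choose r"
proof (induction m)
  case (Suc m)
  obtain r' where r: "r = Suc r'" using Suc.prems by (cases r) auto
  show ?case
  proof (cases "r = Suc m")
    case False
    then have "Suc m \<le> Suc m choose r" using Suc by simp
    moreover have "Suc m choose r' > 0" using Suc.prems r by simp
    ultimately show ?thesis unfolding r binomial_Suc_Suc[of "Suc m"] by linarith
  qed (use binomial_Suc_n[of "Suc m"] in simp)
qed simp

text \<open>
  The absorption identity turns the right-hand side into the binomial coefficient of \<open>3 n - 1\<close> from
  \<open>k + 4 n\<close>, divided by \<open>3 n\<close>. Only one term of a Vandermonde sum for this coefficient is kept: it
  contains \<open>k + n - 1\<close> choose \<open>n\<close>, which dominates \<open>k^n / n!\<close>, and a factor of at least \<open>3 n\<close>.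
\<close>

lemma binomial_dominates_power:
  assumes "n > 0"
  shows "real k ^ n / fact n \<le> real ((k + 4 * n) choose (3 * n)) / real (k + n + 1)"
proof -
  let ?C = "(k + 4 * n) choose (3 * n - 1)"
  have "((k + n - 1) choose n) * ((3 * n + 1) choose (2 * n - 1)) \<le>
      (\<Sum>j\<le>3 * n - 1. ((k + n - 1) choose j) * ((3 * n + 1) choose (3 * n - 1 - j)))"
    by (rule order_trans[OF _ member_le_sum[of n]]) (use assms in \<open>auto simp: le_Suc_eq\<close>)
  also have "\<dots> = (k + n - 1 + (3 * n + 1)) choose (3 * n - 1)" by (rule vandermonde)
  also have "k + n - 1 + (3 * n + 1) = k + 4 * n" using assms by simp
  finally have vm: "((k + n - 1) choose n) * ((3 * n + 1) choose (2 * n - 1)) \<le> ?C" .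
  have ge: "3 * n \<le> (3 * n + 1) choose (2 * n - 1)"
  proof -
    have "Suc (3 * n) \<le> Suc (3 * n) choose (2 * n - 1)"
      by (rule Suc_le_binomial) (use assms in linarith)+
    then show ?thesis by simp
  qed
  have "k ^ n * (3 * n) \<le> fact n * ((k + n - 1) choose n) * ((3 * n + 1) choose (2 * n - 1))"
    using power_le_fact_mult_binomial ge by (rule mult_le_mono)
  also have "\<dots> \<le> fact n * ?C" using vm by (simp add: mult.assoc)
  finally have A: "k ^ n * (3 * n) \<le> fact n * ?C" .
  have absorb: "3 * n * ((k + 4 * n) choose (3 * n)) = (k + n + 1) * ?C"
  proof -
    have "Suc (3 * n - 1) * (Suc ((3 * n - 1) + (k + n)) choose Suc (3 * n - 1)) =
        Suc (k + n) * (Suc ((3 * n - 1) + (k + n)) choose (3 * n - 1))"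
      by (rule Suc_times_binomial_add)
    then show ?thesis using assms by (simp add: add.commute)
  qed
  have "k ^ n * (k + n + 1) * (3 * n) \<le> fact n * ?C * (k + n + 1)"
    using mult_le_mono1[OF A, of "k + n + 1"] by (simp add: mult_ac)
  also have "\<dots> = fact n * ((k + 4 * n) choose (3 * n)) * (3 * n)"
    using absorb by (metis mult.assoc mult.commute)
  finally have "k ^ n * (k + n + 1) \<le> fact n * ((k + 4 * n) choose (3 * n))" using assms by simp
  then have "real (k ^ n * (k + n + 1)) \<le> real (fact n * ((k + 4 * n) choose (3 * n)))"
    by (simp only: of_nat_le_iff)
  then show ?thesis by (simp add: field_simps)
qed

text \<open>
  Discard the head \<open>y\<close> of the decreasing list together with one element of \<open>M\<close>, namely \<open>y\<close> itself if
  it occurs in \<open>M\<close> and an arbitrary element otherwise; that element is at most \<open>y\<close>, and the rest of \<open>M\<close>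
  lies in the tail.
\<close>

lemma prod_mset_le_prod_take:
  assumes "sorted (rev ys)" "M \<subseteq># mset ys"
  shows "prod_mset M \<le> prod_list (take (size M) (ys :: nat list))"
  using assms
proof (induction ys arbitrary: M)
  case Nil
  then show ?case by simp
next
  case (Cons y ys)
  show ?case
  proof (cases "M = {#}")
    case False
    have le: "z \<le> y" if "z \<in># M" for z
      using that Cons.prems mset_subset_eqD[of M "mset (y # ys)" z] by (auto simp: sorted_append)
    obtain z N where M: "M = add_mset z N" and N: "N \<subseteq># mset ys"
    proof (cases "y \<in># M")
      case True
      then obtain N where "M = add_mset y N" by (metis mset_add)
      then show ?thesis using that Cons.prems by simp
    next
      case no: False
      obtain z N where "M = add_mset z N" using False by (metis multiset_cases)
      moreover have "M \<subseteq># mset ys"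
        using Cons.prems(2) no by (metis diff_single_trivial subset_eq_diff_conv add_mset_add_single mset.simps(2))
      ultimately show ?thesis using that by (metis mset_subset_eq_insertD subset_mset.less_imp_le)
    qed
    have "prod_mset N \<le> prod_list (take (size N) ys)"
      using Cons.IH[OF _ N] Cons.prems by (simp add: sorted_append)
    then show ?thesis using le[of z] M by (simp add: mult_le_mono)
  qed simp
qed

lemma prod_le_prod_take_sort:
  fixes xs :: "nat list"
  assumes "finite S" "inj_on \<sigma> S" "\<sigma> ` S \<subseteq> {..<length xs}"
  shows "(\<Prod>j\<in>S. xs ! \<sigma> j) \<le> prod_list (take (card S) (rev (sort xs)))"
proof -
  let ?M = "image_mset ((!) xs) (mset_set (\<sigma> ` S))"
  have "mset_set (\<sigma> ` S) \<subseteq># mset_set {..<length xs}"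
    using assms(3) by (intro subset_imp_msubset_mset_set) auto
  then have "?M \<subseteq># image_mset ((!) xs) (mset_set {..<length xs})" by (rule image_mset_subseteq_mono)
  also have "\<dots> = mset xs"
    by (metis lessThan_atLeast0 map_nth mset_map mset_upt)
  finally have "?M \<subseteq># mset (rev (sort xs))" by simp
  then have "prod_mset ?M \<le> prod_list (take (size ?M) (rev (sort xs)))"
    by (intro prod_mset_le_prod_take) simp_all
  moreover have "prod_mset ?M = (\<Prod>j\<in>S. xs ! \<sigma> j)"
    using assms(2) by (simp add: prod.reindex flip: prod_unfold_prod_mset)
  moreover have "size ?M = card S" using assms(2) by (simp add: card_image)
  ultimately show ?thesis by simp
qed

section \<open>Cells of isolated solutions\<close>

definition exponent_vector :: "('n \<Rightarrow> nat) \<Rightarrow> real^'n::finite"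
  where "exponent_vector i = (\<chi> l. real (i l))"

definition support :: "'n::finite trop_poly \<Rightarrow> (real^'n) set"
  where "support f = exponent_vector ` dom f"

text \<open>
  Coefficients indexed by exponent vectors in Euclidean space, so that the intersection theory for
  real exponents applies; meaningful only on the support.
\<close>

definition height :: "'n::finite trop_poly \<Rightarrow> real^'n \<Rightarrow> real"
  where "height f a = the (f (inv exponent_vector a))"

lemma inj_exponent_vector: "inj exponent_vector"
  by (auto simp: inj_def exponent_vector_def vec_eq_iff)

lemma trop_monomial_value_eq:
  "trop_monomial_value f i x = height f (exponent_vector i) + exponent_vector i \<bullet> x"
  unfolding trop_monomial_value_def height_def inv_f_f[OF inj_exponent_vector]
  by (simp add: exponent_vector_def inner_vec_def)

lemma trop_eval_eq: "trop_eval f x = Min ((\<lambda>a. height f a + a \<bullet> x) ` support f)"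
  by (simp add: trop_eval_def support_def image_image trop_monomial_value_eq)

lemma finite_support: "tropical_polynomial f \<Longrightarrow> finite (support f)"
  and support_nonempty: "tropical_polynomial f \<Longrightarrow> support f \<noteq> {}"
  by (auto simp: tropical_polynomial_def support_def)

lemma trop_eval_le:
  assumes "tropical_polynomial f" "a \<in> support f"
  shows "trop_eval f x \<le> height f a + a \<bullet> x"
  unfolding trop_eval_eq using assms finite_support by (intro Min_le) auto

abbreviation supports :: "'n::finite trop_poly list \<Rightarrow> nat \<Rightarrow> (real^'n) set"
  where "supports fs i \<equiv> support (fs ! i)"

abbreviation heights :: "'n::finite trop_poly list \<Rightarrow> nat \<Rightarrow> real^'n \<Rightarrow> real"
  where "heights fs i \<equiv> height (fs ! i)"

lemma active_supports_iff:
  assumes "tropical_polynomial (fs ! i)"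
  shows "a \<in> active (supports fs) (heights fs) x i \<longleftrightarrow>
    a \<in> support (fs ! i) \<and> height (fs ! i) a + a \<bullet> x = trop_eval (fs ! i) x"
proof -
  have "(\<forall>b\<in>support (fs ! i). height (fs ! i) a + a \<bullet> x \<le> height (fs ! i) b + b \<bullet> x) \<longleftrightarrow>
      height (fs ! i) a + a \<bullet> x \<le> trop_eval (fs ! i) x"
    unfolding trop_eval_eq using finite_support[OF assms] support_nonempty[OF assms]
    by (subst Min_ge_iff) auto
  then show ?thesis unfolding active_def using trop_eval_le[OF assms, of a x] by auto
qed

lemma trop_zero_iff_active:
  assumes "tropical_polynomial (fs ! i)"
  shows "trop_zero (fs ! i) x \<longleftrightarrow>
    (\<exists>a\<in>active (supports fs) (heights fs) x i. \<exists>b\<in>active (supports fs) (heights fs) x i. a \<noteq> b)"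
proof -
  have "active (supports fs) (heights fs) x i =
      exponent_vector ` {m \<in> dom (fs ! i). trop_monomial_value (fs ! i) m x = trop_eval (fs ! i) x}"
    unfolding set_eq_iff active_supports_iff[OF assms] trop_monomial_value_eq by (auto simp: support_def)
  then show ?thesis
    unfolding trop_zero_def by (auto simp: inj_eq[OF inj_exponent_vector])
qed

lemma active_supports_nonempty:
  assumes "tropical_polynomial (fs ! i)"
  shows "active (supports fs) (heights fs) x i \<noteq> {}"
proof -
  have "trop_eval (fs ! i) x \<in> (\<lambda>a. height (fs ! i) a + a \<bullet> x) ` support (fs ! i)"
    unfolding trop_eval_eq using finite_support[OF assms] support_nonempty[OF assms] by (intro Min_in) auto
  then show ?thesis using active_supports_iff[OF assms] by auto
qed

lemma trop_prevariety_iff: "x \<in> trop_prevariety fs \<longleftrightarrow> (\<forall>i<length fs. trop_zero (fs ! i) x)"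
  by (auto simp: trop_prevariety_def all_set_conv_all_nth)

text \<open>
  Along a direction in which every initial form keeps two minimal monomials, the points near \<open>x\<close> are
  solutions as well.
\<close>

lemma isolated_no_tying_direction:
  assumes poly: "\<And>f. f \<in> set fs \<Longrightarrow> tropical_polynomial f"
    and x: "x isolated_in trop_prevariety fs"
    and v: "\<And>i. i < length fs \<Longrightarrow>
      \<exists>a\<in>active (active (supports fs) (heights fs) x) (\<lambda>_ _. 0) v i.
      \<exists>b\<in>active (active (supports fs) (heights fs) x) (\<lambda>_ _. 0) v i. a \<noteq> b"
  shows "v = 0"
proof (rule ccontr)
  assume "v \<noteq> 0"
  have p: "tropical_polynomial (fs ! i)" if "i < length fs" for i using poly that by simp
  obtain \<epsilon> where \<epsilon>: "\<epsilon> > 0" "\<And>y. y \<in> trop_prevariety fs \<Longrightarrow> dist x y < \<epsilon> \<Longrightarrow> y = x"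
    using x unfolding isolated_in_dist_Ex_iff by blast
  have "eventually (\<lambda>e. \<forall>i\<in>{..<length fs}. active (active (supports fs) (heights fs) x) (\<lambda>_ _. 0) v i
      \<subseteq> active (supports fs) (heights fs) (x + e *\<^sub>R v) i) (at_right 0)"
    by (rule active_perturb) (use finite_support p in auto)
  moreover have "eventually (\<lambda>e. e < \<epsilon> / norm v \<and> e > 0) (at_right 0)"
    using \<epsilon>(1) \<open>v \<noteq> 0\<close> by (intro eventually_conj eventually_at_right_less)
      (auto simp: eventually_at_right[of 0 1] intro!: exI[of _ "\<epsilon> / norm v"])
  ultimately have "eventually (\<lambda>e. (\<forall>i\<in>{..<length fs}. active (active (supports fs) (heights fs) x) (\<lambda>_ _. 0) v i
      \<subseteq> active (supports fs) (heights fs) (x + e *\<^sub>R v) i) \<and> e < \<epsilon> / norm v \<and> e > 0) (at_right 0)"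
    by (rule eventually_conj)
  from eventually_happens'[OF trivial_limit_at_right_real this]
  obtain e where e: "e < \<epsilon> / norm v" "e > 0" and sub: "\<And>i. i < length fs \<Longrightarrow>
      active (active (supports fs) (heights fs) x) (\<lambda>_ _. 0) v i \<subseteq> active (supports fs) (heights fs) (x + e *\<^sub>R v) i"
    by blast
  have "trop_zero (fs ! i) (x + e *\<^sub>R v)" if "i < length fs" for i
    unfolding trop_zero_iff_active[OF p[OF that]] using v[OF that] sub[OF that] by blast
  then have "x + e *\<^sub>R v \<in> trop_prevariety fs" by (simp add: trop_prevariety_iff)
  moreover have "dist x (x + e *\<^sub>R v) < \<epsilon>"
    using e \<open>v \<noteq> 0\<close> by (simp add: dist_norm pos_less_divide_eq)
  ultimately have "x + e *\<^sub>R v = x" by (rule \<epsilon>(2))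
  then show False using e \<open>v \<noteq> 0\<close> by simp
qed

lemma support_bounds:
  assumes "tropical_polynomial f" "a \<in> support f"
  shows "0 \<le> a $ l" "(\<Sum>l\<in>UNIV. a $ l) \<le> real (trop_degree f)" "a $ l \<in> \<int>"
proof -
  obtain i where i: "i \<in> dom f" "a = exponent_vector i" using assms(2) by (auto simp: support_def)
  show "0 \<le> a $ l" "a $ l \<in> \<int>" by (auto simp: i exponent_vector_def)
  have "trop_monomial_degree i \<le> trop_degree f"
    unfolding trop_degree_def using i assms(1) by (intro Max_ge) (auto simp: tropical_polynomial_def)
  then show "(\<Sum>l\<in>UNIV. a $ l) \<le> real (trop_degree f)"
    by (simp add: i exponent_vector_def trop_monomial_degree_def flip: of_nat_sum)
qed

lemma trop_zero_degree_pos: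
  assumes "tropical_polynomial f" "trop_zero f x"
  shows "trop_degree f > 0"
proof (rule ccontr)
  assume "\<not> ?thesis"
  then have "trop_monomial_degree i = 0" if "i \<in> dom f" for i
    using that assms(1) Max_ge[of "trop_monomial_degree ` dom f" "trop_monomial_degree i"]
    by (auto simp: tropical_polynomial_def trop_degree_def)
  then have "i = (\<lambda>_. 0)" if "i \<in> dom f" for i
    using that by (fastforce simp: trop_monomial_degree_def)
  then show False using assms(2) unfolding trop_zero_def by metis
qed

definition normalized_eval :: "'n::finite trop_poly list \<Rightarrow> real^'n \<Rightarrow> real"
  where "normalized_eval fs z = (\<Sum>i<length fs. trop_eval (fs ! i) z / real (trop_degree (fs ! i)))"

text \<open>
  The cell \<open>P\<close> is the weighted sum of the segments \<open>[q j, p' j]\<close> of the transversal and of one active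
  exponent for each remaining polynomial. For the uniform formula \<open>r\<close> below, polynomial \<open>i\<close> contributes
  the segment from \<open>c i\<close> to \<open>e i\<close>, degenerate unless \<open>i\<close> is matched. A point of the cell is a
  sum of convex combinations of active exponents. Each active exponent of a polynomial is a
  supergradient of it at \<open>x\<close>, nonnegative and with coordinate sum at most the degree, and these
  properties pass to convex combinations and to the weighted sum.
\<close>

lemma isolated_cell:
  fixes fs :: "'n::finite trop_poly list"
  assumes poly: "\<And>f. f \<in> set fs \<Longrightarrow> tropical_polynomial f"
    and x: "x isolated_in trop_prevariety fs"
  shows "\<exists>P. convex P \<and> P \<subseteq> {y. (\<forall>l. 0 \<le> y $ l) \<and> (\<Sum>l\<in>UNIV. y $ l) \<le> real (length fs)} \<and>
    1 \<le> real (greatest_degrees_prod CARD('n) fs) * measure lebesgue P \<and>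
    (\<forall>y\<in>P. \<forall>z. normalized_eval fs z \<le> normalized_eval fs x + y \<bullet> (z - x))"
proof -
  let ?k = "length fs"
  have p: "tropical_polynomial (fs ! i)" if "i < ?k" for i using poly that by simp
  have zero: "trop_zero (fs ! i) x" if "i < ?k" for i
    using x that unfolding isolated_in_def trop_prevariety_iff by blast
  define d where "d = (\<lambda>i. trop_degree (fs ! i))"
  have d: "d i > 0" if "i < ?k" for i unfolding d_def using p zero that trop_zero_degree_pos by blast
  define A where "A = active (supports fs) (heights fs) x"
  have A: "a \<in> support (fs ! i)" "height (fs ! i) a + a \<bullet> x = trop_eval (fs ! i) x"
    if "i < ?k" "a \<in> A i" for i a
    using that active_supports_iff[OF p] unfolding A_def by blast+
  obtain \<sigma> p' q where \<sigma>: "inj \<sigma>" "range \<sigma> \<subseteq> {..<?k}" and pq: "\<And>j. p' j \<in> A (\<sigma> j)" "\<And>j. q j \<in> A (\<sigma> j)"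
    and det: "det (\<chi> j. p' j - q j) \<noteq> 0"
  proof (rule transversal_if_isolated)
    show "finite (A i)" if "i \<in> {..<?k}" for i
      using that finite_support[OF p] active_subset[of "supports fs" "heights fs" x i] unfolding A_def
      by (auto intro: finite_subset)
    show "\<exists>a\<in>A i. \<exists>b\<in>A i. a \<noteq> b" if "i \<in> {..<?k}" for i
      using zero trop_zero_iff_active[OF p] that unfolding A_def by auto
    show "v = 0" if "\<And>i. i \<in> {..<?k} \<Longrightarrow> \<exists>a\<in>active A (\<lambda>_ _. 0) v i. \<exists>b\<in>active A (\<lambda>_ _. 0) v i. a \<noteq> b" for v
      using isolated_no_tying_direction[OF poly x] that unfolding A_def by blast
  qed (rule that, assumption+)
  have \<sigma>k: "\<sigma> j < ?k" for j using \<sigma>(2) by auto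
  \<comment> \<open>Off the range of \<open>\<sigma>\<close> the value of \<open>\<rho>\<close> is arbitrary; there \<open>e i = c i\<close>, so the parameter has no effect.\<close>
  define \<rho> where "\<rho> = inv \<sigma>"
  have \<rho>: "\<rho> (\<sigma> j) = j" for j using \<sigma>(1) by (simp add: \<rho>_def)
  define c where "c = (\<lambda>i. if i \<in> range \<sigma> then q (\<rho> i) else (SOME a. a \<in> A i))"
  define e where "e = (\<lambda>i. if i \<in> range \<sigma> then p' (\<rho> i) else c i)"
  have cA: "c i \<in> A i" if "i < ?k" for i
    using pq(2) active_supports_nonempty[OF p[OF that], of x] \<rho>
    by (auto simp: c_def A_def[symmetric] some_in_eq)
  have eA: "e i \<in> A i" if "i < ?k" for i using pq(1) cA[OF that] \<rho> by (auto simp: e_def)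
  define L where "L = (\<lambda>t :: real^'n. \<Sum>j\<in>UNIV. (t $ j / real (d (\<sigma> j))) *\<^sub>R (p' j - q j))"
  define b where "b = (\<Sum>i<?k. (1 / real (d i)) *\<^sub>R c i)"
  define r where "r = (\<lambda>(t :: real^'n) i. (1 - t $ \<rho> i) *\<^sub>R c i + (t $ \<rho> i) *\<^sub>R e i)"
  have point: "b + L t = (\<Sum>i<?k. (1 / real (d i)) *\<^sub>R r t i)" for t
  proof -
    have "(\<Sum>i<?k. (1 / real (d i)) *\<^sub>R r t i) = b + (\<Sum>i<?k. (t $ \<rho> i / real (d i)) *\<^sub>R (e i - c i))"
      unfolding b_def sum.distrib[symmetric] r_def
      by (rule sum.cong) (simp_all add: algebra_simps add_divide_distrib)
    also have "(\<Sum>i<?k. (t $ \<rho> i / real (d i)) *\<^sub>R (e i - c i)) =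
        (\<Sum>i\<in>range \<sigma>. (t $ \<rho> i / real (d i)) *\<^sub>R (e i - c i))"
      using \<sigma>(2) by (intro sum.mono_neutral_right) (auto simp: e_def)
    also have "\<dots> = L t"
      unfolding L_def by (subst sum.reindex[OF \<sigma>(1)]) (simp add: \<rho> e_def c_def)
    finally show ?thesis by simp
  qed
  define P where "P = (+) b ` L ` cbox 0 1"
  have P: "\<exists>t. y = (\<Sum>i<?k. (1 / real (d i)) *\<^sub>R r t i) \<and> (\<forall>j. 0 \<le> t $ j \<and> t $ j \<le> 1)" if "y \<in> P" for y
    using that point by (auto simp: P_def mem_box_cart)
  have "linear L"
    by (rule linearI) (simp_all add: L_def add_divide_distrib scaleR_add_left sum.distrib scaleR_sum_right)
  then have "convex P" unfolding P_def
    by (intro convex_translation convex_linear_image convex_box)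
  moreover have "y \<in> {y. (\<forall>l. 0 \<le> y $ l) \<and> (\<Sum>l\<in>UNIV. y $ l) \<le> real ?k}" if yP: "y \<in> P" for y
  proof -
    obtain t where y: "y = (\<Sum>i<?k. (1 / real (d i)) *\<^sub>R r t i)" and t: "\<And>j. 0 \<le> t $ j \<and> t $ j \<le> 1"
      using P[OF yP] by blast
    have c0: "0 \<le> c i $ l" "0 \<le> e i $ l" if "i < ?k" for i l
      using support_bounds(1)[OF p[OF that]] A(1)[OF that] cA[OF that] eA[OF that] by blast+
    have r0: "0 \<le> r t i $ l" if "i < ?k" for i l
      using c0[OF that] t[of "\<rho> i"] by (simp add: r_def)
    have cd: "(\<Sum>l\<in>UNIV. c i $ l) \<le> d i" "(\<Sum>l\<in>UNIV. e i $ l) \<le> d i" if "i < ?k" for i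
      unfolding d_def using support_bounds(2)[OF p[OF that]] A(1)[OF that] cA[OF that] eA[OF that] by blast+
    have rd: "(\<Sum>l\<in>UNIV. r t i $ l) \<le> d i" if "i < ?k" for i
    proof -
      have "(\<Sum>l\<in>UNIV. r t i $ l) = (1 - t $ \<rho> i) * (\<Sum>l\<in>UNIV. c i $ l) + t $ \<rho> i * (\<Sum>l\<in>UNIV. e i $ l)"
        by (simp add: r_def sum.distrib sum_distrib_left)
      also have "\<dots> \<le> (1 - t $ \<rho> i) * d i + t $ \<rho> i * d i"
        using cd[OF that] t[of "\<rho> i"] by (intro add_mono mult_left_mono) auto
      finally show ?thesis by (simp add: algebra_simps)
    qed
    have "(\<Sum>l\<in>UNIV. y $ l) = (\<Sum>l\<in>UNIV. \<Sum>i<?k. r t i $ l / d i)" by (simp add: y)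
    also have "\<dots> = (\<Sum>i<?k. (\<Sum>l\<in>UNIV. r t i $ l) / d i)"
      by (subst sum.swap) (simp add: sum_divide_distrib)
    also have "\<dots> \<le> (\<Sum>i<?k. 1)" using rd d by (intro sum_mono) (simp add: divide_le_eq_1)
    finally have "(\<Sum>l\<in>UNIV. y $ l) \<le> real ?k" by simp
    moreover have "0 \<le> y $ l" for l using r0 by (auto simp: y intro!: sum_nonneg)
    ultimately show ?thesis by simp
  qed
  moreover have "1 \<le> real (greatest_degrees_prod CARD('n) fs) * measure lebesgue P"
  proof -
    have "p' j $ l \<in> \<int>" "q j $ l \<in> \<int>" for j l
      using support_bounds(3)[OF p[OF \<sigma>k]] A(1)[OF \<sigma>k] pq by blast+
    then have int: "(p' j - q j) $ l \<in> \<int>" for j l by simp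
    have "(\<Prod>j\<in>UNIV. d (\<sigma> j)) = (\<Prod>j\<in>UNIV. map trop_degree fs ! \<sigma> j)"
      using \<sigma>k by (simp add: d_def)
    then have "(\<Prod>j\<in>UNIV. d (\<sigma> j)) \<le> greatest_degrees_prod CARD('n) fs"
      unfolding greatest_degrees_prod_def
      using prod_le_prod_take_sort[of UNIV \<sigma> "map trop_degree fs"] \<sigma> by simp
    then have le: "(\<Prod>j\<in>UNIV. real (d (\<sigma> j))) \<le> real (greatest_degrees_prod CARD('n) fs)"
      by (simp flip: of_nat_prod)
    have "1 \<le> (\<Prod>j\<in>UNIV. real (d (\<sigma> j))) * measure lebesgue (L ` cbox 0 1)"
      unfolding L_def by (rule measure_lattice_parallelepiped[OF int det]) (rule d[OF \<sigma>k])
    also have "measure lebesgue (L ` cbox 0 1) = measure lebesgue P"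
      by (simp add: P_def measure_translation)
    also have "(\<Prod>j\<in>UNIV. real (d (\<sigma> j))) * measure lebesgue P \<le>
        real (greatest_degrees_prod CARD('n) fs) * measure lebesgue P"
      using le by (rule mult_right_mono) simp
    finally show ?thesis .
  qed
  moreover have "normalized_eval fs z \<le> normalized_eval fs x + y \<bullet> (z - x)" if yP: "y \<in> P" for y z
  proof -
    obtain t where y: "y = (\<Sum>i<?k. (1 / real (d i)) *\<^sub>R r t i)" and t: "\<And>j. 0 \<le> t $ j \<and> t $ j \<le> 1"
      using P[OF yP] by blast
    have "trop_eval (fs ! i) z \<le> trop_eval (fs ! i) x + r t i \<bullet> (z - x)" if i: "i < ?k" for i
    proof -
      have le: "trop_eval (fs ! i) z \<le> trop_eval (fs ! i) x + a \<bullet> (z - x)" if "a \<in> A i" for a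
        using trop_eval_le[OF p[OF i] A(1)[OF i that], of z] A(2)[OF i that] by (simp add: inner_diff_right)
      have "trop_eval (fs ! i) z = (1 - t $ \<rho> i) * trop_eval (fs ! i) z + t $ \<rho> i * trop_eval (fs ! i) z"
        by (simp add: algebra_simps)
      also have "\<dots> \<le> (1 - t $ \<rho> i) * (trop_eval (fs ! i) x + c i \<bullet> (z - x)) + t $ \<rho> i * (trop_eval (fs ! i) x + e i \<bullet> (z - x))"
        using le[OF cA[OF i]] le[OF eA[OF i]] t[of "\<rho> i"] by (intro add_mono mult_left_mono) auto
      also have "\<dots> = trop_eval (fs ! i) x + r t i \<bullet> (z - x)"
        by (simp add: r_def inner_add_left algebra_simps)
      finally show ?thesis .
    qed
    then have "normalized_eval fs z \<le> (\<Sum>i<?k. (trop_eval (fs ! i) x + r t i \<bullet> (z - x)) / real (d i))"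
      unfolding normalized_eval_def d_def by (intro sum_mono divide_right_mono) auto
    also have "\<dots> = normalized_eval fs x + y \<bullet> (z - x)"
      by (simp add: normalized_eval_def d_def y inner_sum_left add_divide_distrib sum.distrib)
    finally show ?thesis .
  qed
  ultimately show ?thesis by blast
qed

theorem corollary9p4:
  fixes fs :: "'n::finite trop_poly list" and k n :: nat
  assumes n: "n = CARD('n)"
    and k: "length fs = k" "k \<ge> n"
    and poly: "\<And>f. f \<in> set fs \<Longrightarrow> tropical_polynomial f"
  shows "finite {x. x isolated_in trop_prevariety fs} \<and>
    real (card {x. x isolated_in trop_prevariety fs})
      \<le> real ((k + 4 * n) choose (3 * n)) / real (k + n + 1) * real (greatest_degrees_prod n fs)"
proof -
  let ?I = "{x. x isolated_in trop_prevariety fs}" and ?D = "real (greatest_degrees_prod n fs)"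
  define B where "B = {y :: real^'n. (\<forall>l. 0 \<le> y $ l) \<and> (\<Sum>l\<in>UNIV. y $ l) \<le> real k}"
  have n0: "n > 0" using n by simp
  then have k0: "real k > 0" using k by simp
  have "\<forall>x\<in>?I. \<exists>P. convex P \<and> P \<subseteq> B \<and> 1 \<le> ?D * measure lebesgue P \<and>
      (\<forall>y\<in>P. \<forall>z. normalized_eval fs z \<le> normalized_eval fs x + y \<bullet> (z - x))"
    using isolated_cell[OF poly] unfolding B_def n k(1)[symmetric] by blast
  from bchoice[OF this] obtain P where P: "\<And>x. x \<in> ?I \<Longrightarrow> convex (P x)" "\<And>x. x \<in> ?I \<Longrightarrow> P x \<subseteq> B"
    "\<And>x. x \<in> ?I \<Longrightarrow> 1 \<le> ?D * measure lebesgue (P x)"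
    "\<And>x y z. x \<in> ?I \<Longrightarrow> y \<in> P x \<Longrightarrow> normalized_eval fs z \<le> normalized_eval fs x + y \<bullet> (z - x)"
    by blast
  have B: "B \<in> lmeasurable" "bounded B" "measure lebesgue B = real k ^ n / fact n"
    using measure_scaled_simplex[OF k0, where 'n = 'n] unfolding B_def n by auto
  have bound: "real (card F) \<le> real k ^ n / fact n * ?D" if F: "finite F" "F \<subseteq> ?I" for F
  proof (cases "?D = 0")
    case True
    then have "?I = {}" using P(3) by fastforce
    then show ?thesis using F by simp
  next
    case False
    have "real (card F) * (1 / ?D) \<le> measure lebesgue B"
    proof (rule convex_packing_card[OF F(1), of P])
      fix x assume "x \<in> F"
      then have x: "x \<in> ?I" using F by blast
      show "convex (P x)" "P x \<subseteq> B" using P x by blast+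
      show "1 / ?D \<le> measure lebesgue (P x)" using P(3)[OF x] False by (simp add: field_simps)
      fix x' assume "x' \<in> F" "x \<noteq> x'"
      then show "interior (P x) \<inter> P x' = {}"
        using supergradient_cells_disjoint[of "P x" "normalized_eval fs" x "P x'" x'] P(4) x F(2) by blast
    qed (use B in auto)
    then show ?thesis using False by (simp add: B(3) field_simps)
  qed
  have "finite ?I"
  proof (rule finite_if_finite_subsets_card_bdd[of _ "nat \<lfloor>real k ^ n / fact n * ?D\<rfloor>", THEN conjunct1])
    fix F assume "F \<subseteq> ?I" "finite F"
    then show "card F \<le> nat \<lfloor>real k ^ n / fact n * ?D\<rfloor>" using bound by (simp add: le_nat_floor)
  qed
  moreover from this have "real (card ?I) \<le> real k ^ n / fact n * ?D" by (intro bound) auto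
  moreover have "\<dots> \<le> real ((k + 4 * n) choose (3 * n)) / real (k + n + 1) * ?D"
    by (intro mult_right_mono binomial_dominates_power n0) simp
  ultimately show ?thesis by linarith
qed

end
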